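(* Let $\mathcal{O}(-1)\oplus\mathcal{O}(-1)\to\mathbb{CP}^1$ carry its $SU(2)^2$-invariant asymptotically conical Calabi-Yau (Candelas-de la Ossa) structure. Let $R_\epsilon$ be the one-parameter family of invariant instantons, and $R'_0$ the invariant abelian instanton, extending over $\mathcal{O}(-1)\oplus\mathcal{O}(-1)$ (both defined in the context). Then, in the limit $\epsilon\to\infty$: (i) Up to an appropriate rescaling, $R_\epsilon$ bubbles off a family of anti-self-dual connections along $\mathbb{CP}^1\subset\mathcal{O}(-1)\oplus\mathcal{O}(-1)$. (ii) Without this rescaling, $R_\epsilon$ converges uniformly to $R'_0$ on compact subsets of $\mathcal{O}(-1)\oplus\mathcal{O}(-1)\setminus\mathbb{CP}^1$.
   Context: Frame. $\mathfrak{su}(2)$ has basis $E_1=\begin{pmatrix} i&0\\0&-i\end{pmatrix}$, $E_2=\begin{pmatrix}0&1\\-1&0\end{pmatrix}$, $E_3=\begin{pmatrix}0&i\\i&0\end{pmatrix}$. On $SU(2)^2$ let $u^1,v^1,w^1,u^2,v^2,w^2$ be the left-invariant 1-forms dual to $(E_1,0),(E_2,0),(E_3,0),(0,E_1),(0,E_2),(0,E_3)$, and $u^\pm=\frac12(u^1\pm u^2)$. $\triangle U(1)$ is the diagonal circle generated by $(E_1,E_1)$. On $SU(2)^2/\triangle U(1)$ set $\eta^{se}=\frac43u^-$, $\omega_0^{se}=\frac23(v^1\wedge w^1+v^2\wedge w^2)$, $\omega_1^{se}=-\frac23(v^1\wedge w^1-v^2\wedge w^2)$, $\omega_2^{se}=\frac23(v^1\wedge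 v^2+w^1\wedge w^2)$, $\omega_3^{se}=\frac23(v^1\wedge w^2-w^1\wedge v^2)$. Manifold and Calabi-Yau structure. $\mathcal{O}(-1)\oplus\mathcal{O}(-1)=SU(2)^2\times_{U(1)\times SU(2)}\mathbb{H}$, where $(e^{i\theta},q)\cdot v=qve^{-i\theta}$; its zero section is $\mathbb{CP}^1=SU(2)^2/(U(1)\times SU(2))$. The complement of the zero section is $(0,\infty)\times SU(2)^2/\triangle U(1)$, with $t$ the geodesic distance to $\mathbb{CP}^1$. There $\omega=dt\wedge\eta+\omega_1$, $\Omega=(dt+i\eta)\wedge(\omega_2+i\omega_3)$, with $\eta=\lambda\eta^{se}$, $\omega_1=u_0\omega_0^{se}+u_1\omega_1^{se}$, $\omega_2=\mu\omega_2^{se}$, $\omega_3=\mu\omega_3^{se}$, where (fixing the overall scale) $u_0=-1$, $u_1(0)=1$, $\dot u_1=2\lambda$, $\mu^2=u_1^2-1$, $\lambda^2=\dfrac{u_1^3-3u_1+2}{u_1^2-1}$, and $\lambda,\mu>0$ for $t>0$. Bundles and instantons. $P_{0,\mathrm{Id}}$ and $P_{1,\mathbf{0}}$ are the $SU(2)^2$-invariant $SU(2)$-bundles $SU(2)^2\times_{U(1)\times SU(2)}(\mathbb{H}\times SU(2))$ with $U(1)\times SU(2)$ acting on the fibre $SU(2)$ through $(e^{i\theta},q)\mapsto q$, respectively $(e^{i\theta},q)\mapsto\mathrm{diag}(e^{i\theta},e^{-i\theta})$; they are equivariantly isomorphic over the complement of $\mathbb{CP}^1$. A (Calabi-Yau)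 instanton is a connection $A$ with $F_A\wedge\omega^2=0$ and $F_A\wedge\mathrm{Re}\,\Omega=0$. Over the complement of $\mathbb{CP}^1$ the invariant instantons considered here have the form $A=a_2(E_2\otimes v^2+E_3\otimes w^2)+a_0E_1\otimes u^-+E_1\otimes u^+$ with $a_0,a_2$ functions of $t\in(0,\infty)$. $R_\epsilon$ is the unique such instanton extending smoothly over $\mathbb{CP}^1$ on $P_{0,\mathrm{Id}}$ with $a_0=-1+\epsilon t^2+O(t^4)$, $a_2=1-\frac12\epsilon t^2+O(t^4)$ as $t\to0$; for $\epsilon\ge 0$ it is defined over all of $\mathcal{O}(-1)\oplus\mathcal{O}(-1)$. $R'_0$ is the abelian instanton with $a_2=0$ and $a_0=\dfrac{2}{u_1+1}$, which extends smoothly over $\mathbb{CP}^1$ on $P_{1,\mathbf{0}}$. Convergence of connections means convergence of the coefficients of these invariant forms as functions of $t$. Meaning of (i). For $\delta>0$ let $s_\delta$ denote fibrewise multiplication by $\delta$, i.e. the map fixing $\mathbb{CP}^1$ and sending $t\mapsto\delta t$ on the complement. The rescaling in (i) is pull-back by $s_\delta$ for a suitable $\delta=\delta(\epsilon)\to0$ as $\epsilon\to\infty$; "bubbling off a family of anti-self-dual connections along $\mathbb{CP}^1$" means that the rescaled connections $s_\delta^*R_\epsilon$ converge to a connection obtained by lifting to the fibres of $\mathcal{O}(-1)\oplus\mathcal{O}(-1)\to\mathbb{CP}^1$ a non-flat anti-self-dual connection on Euclidean $\mathbb{R}^4$. *)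

theory Defs
  imports "HOL-Analysis.Analysis"
begin

primrec Ck_on :: "nat \<Rightarrow> ('a::real_normed_vector \<Rightarrow> 'b::real_normed_vector) \<Rightarrow> 'a set \<Rightarrow> bool" where
  "Ck_on 0 f S \<longleftrightarrow> continuous_on S f"
| "Ck_on (Suc n) f S \<longleftrightarrow> (\<forall>x\<in>S. f differentiable (at x)) \<and>
     (\<forall>w. Ck_on n (\<lambda>x. frechet_derivative f (at x) w) S)"

(* meant for open S and finite-dimensional domains *)
definition smooth_on :: "('a::real_normed_vector \<Rightarrow> 'b::real_normed_vector) \<Rightarrow> 'a set \<Rightarrow> bool" where
  "smooth_on f S \<longleftrightarrow> (\<forall>n. Ck_on n f S)"


section \<open>SU(2) and its Lie algebra\<close>

type_synonym mat2 = "complex^2^2"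

definition cadj :: "mat2 \<Rightarrow> mat2" where
  "cadj X = (\<chi> i j. cnj (X $ j $ i))"

definition SU2 :: "mat2 set" where
  "SU2 = {g. g ** cadj g = mat 1 \<and> det g = 1}"

definition su2 :: "mat2 set" where
  "su2 = {X. cadj X = - X \<and> trace X = 0}"

definition E1 :: mat2 where "E1 = vector [vector [\<i>, 0], vector [0, - \<i>]]"
definition E2 :: mat2 where "E2 = vector [vector [0, 1], vector [-1, 0]]"
definition E3 :: mat2 where "E3 = vector [vector [0, \<i>], vector [\<i>, 0]]"

(* The basis of the dual of su(2) dual to E1, E2, E3, see su2_expansion. *)
definition coE1 :: "mat2 \<Rightarrow> real" where "coE1 X = Im (X $ 1 $ 1)"
definition coE2 :: "mat2 \<Rightarrow> real" where "coE2 X = Re (X $ 1 $ 2)"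
definition coE3 :: "mat2 \<Rightarrow> real" where "coE3 X = Im (X $ 1 $ 2)"

definition lie :: "mat2 \<Rightarrow> mat2 \<Rightarrow> mat2" where
  "lie X Y = X ** Y - Y ** X"

lemma mat2_eq: "(A::mat2) = B \<longleftrightarrow> A$1$1 = B$1$1 \<and> A$1$2 = B$1$2 \<and> A$2$1 = B$2$1 \<and> A$2$2 = B$2$2"
  by (auto simp: vec_eq_iff forall_2)

lemma E_in_su2: "E1 \<in> su2" "E2 \<in> su2" "E3 \<in> su2"
  by (simp_all add: su2_def cadj_def E1_def E2_def E3_def trace_def sum_2 mat2_eq)

lemma su2_expansion:
  assumes "X \<in> su2"
  shows "X = coE1 X *\<^sub>R E1 + coE2 X *\<^sub>R E2 + coE3 X *\<^sub>R E3"
proof -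
  have "cadj X = - X" and tr: "X $ 1 $ 1 + X $ 2 $ 2 = 0"
    using assms by (simp_all add: su2_def trace_def sum_2)
  then have "cnj (X $ 1 $ 1) = - X $ 1 $ 1" "cnj (X $ 1 $ 2) = - X $ 2 $ 1"
    by (simp_all add: cadj_def mat2_eq)
  moreover have "X $ 2 $ 2 = - X $ 1 $ 1"
    using tr by (simp add: add_eq_0_iff)
  ultimately show ?thesis
    by (simp add: mat2_eq E1_def E2_def E3_def coE1_def coE2_def coE3_def complex_eq_iff)
qed

lemma lie_E: "lie E1 E2 = 2 *\<^sub>R E3" "lie E2 E3 = 2 *\<^sub>R E1" "lie E3 E1 = 2 *\<^sub>R E2"
  by (simp_all add: lie_def E1_def E2_def E3_def matrix_matrix_mult_def sum_2 mat2_eq complex_eq_iff)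


section \<open>Invariant forms on the complement of the zero section\<close>

(* An SU(2)^2-invariant form on (0,infinity) x SU(2)^2 / diagonal U(1) is represented by its
   pull-back to (0,infinity) x SU(2)^2. There, using left-invariant frames, it is a family,
   indexed by t, of alternating forms on R + su(2) + su(2), where (s, X, Y) stands for the vector
   field s d/dt + X + Y. An alternating k-form is a function of lists of k vectors.
   Pull-back is injective, so an equation between forms holds on the quotient iff it
   holds upstairs. *)

type_synonym tvec = "real \<times> mat2 \<times> mat2"

definition tangent :: "tvec set" where
  "tangent = UNIV \<times> su2 \<times> su2"

definition form1 :: "('v \<Rightarrow> 'b) \<Rightarrow> 'v list \<Rightarrow> 'b" where
  "form1 \<phi> xs = \<phi> (hd xs)"

(* Wedge product of a k-form with a form of any degree as a sum over shuffles: I is the set of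
   positions passed to \<alpha>, and the exponent counts the inversions of the shuffle. The product
   m combines the values. Normalised so that dx \<and> dy (v, w) = dx v * dy w - dx w * dy v. *)
definition wedge :: "('a \<Rightarrow> 'b \<Rightarrow> 'c::real_vector) \<Rightarrow> nat \<Rightarrow>
    ('v list \<Rightarrow> 'a) \<Rightarrow> ('v list \<Rightarrow> 'b) \<Rightarrow> 'v list \<Rightarrow> 'c" where
  "wedge m k \<alpha> \<beta> xs =
     (\<Sum>I | I \<subseteq> {..<length xs} \<and> card I = k.
        (-1) ^ card {(i, j). i \<in> I \<and> j < length xs \<and> j \<notin> I \<and> j < i} *\<^sub>R
          m (\<alpha> (nths xs I)) (\<beta> (nths xs (- I))))"

definition dt :: "tvec list \<Rightarrow> real" where "dt = form1 (\<lambda>(s, X, Y). s)"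
definition u1 :: "tvec list \<Rightarrow> real" where "u1 = form1 (\<lambda>(s, X, Y). coE1 X)"
definition v1 :: "tvec list \<Rightarrow> real" where "v1 = form1 (\<lambda>(s, X, Y). coE2 X)"
definition w1 :: "tvec list \<Rightarrow> real" where "w1 = form1 (\<lambda>(s, X, Y). coE3 X)"
definition u2 :: "tvec list \<Rightarrow> real" where "u2 = form1 (\<lambda>(s, X, Y). coE1 Y)"
definition v2 :: "tvec list \<Rightarrow> real" where "v2 = form1 (\<lambda>(s, X, Y). coE2 Y)"
definition w2 :: "tvec list \<Rightarrow> real" where "w2 = form1 (\<lambda>(s, X, Y). coE3 Y)"

definition u_plus :: "tvec list \<Rightarrow> real" where "u_plus xs = (u1 xs + u2 xs) / 2"
definition u_minus :: "tvec list \<Rightarrow> real" where "u_minus xs = (u1 xs - u2 xs) / 2"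

abbreviation wedge11 :: "(tvec list \<Rightarrow> real) \<Rightarrow> (tvec list \<Rightarrow> real) \<Rightarrow> tvec list \<Rightarrow> real" where
  "wedge11 \<equiv> wedge (*) 1"

definition eta_se :: "tvec list \<Rightarrow> real" where
  "eta_se xs = 4/3 * u_minus xs"
definition omega0_se :: "tvec list \<Rightarrow> real" where
  "omega0_se xs = 2/3 * (wedge11 v1 w1 xs + wedge11 v2 w2 xs)"
definition omega1_se :: "tvec list \<Rightarrow> real" where
  "omega1_se xs = - (2/3) * (wedge11 v1 w1 xs - wedge11 v2 w2 xs)"
definition omega2_se :: "tvec list \<Rightarrow> real" where
  "omega2_se xs = 2/3 * (wedge11 v1 v2 xs + wedge11 w1 w2 xs)"
definition omega3_se :: "tvec list \<Rightarrow> real" where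
  "omega3_se xs = 2/3 * (wedge11 v1 w2 xs - wedge11 w1 v2 xs)"


section \<open>The Candelas-de la Ossa structure\<close>

(* up is the coefficient u_1 of \<omega>_1; the coefficient u_0 is the constant -1. *)
definition candelas_de_la_ossa ::
    "(real \<Rightarrow> real) \<Rightarrow> (real \<Rightarrow> real) \<Rightarrow> (real \<Rightarrow> real) \<Rightarrow> bool" where
  "candelas_de_la_ossa up lam mu \<longleftrightarrow>
     continuous_on {0..} up \<and> up 0 = 1 \<and>
     (\<forall>t>0. (up has_real_derivative 2 * lam t) (at t) \<and>
        mu t ^ 2 = up t ^ 2 - 1 \<and>
        lam t ^ 2 = (up t ^ 3 - 3 * up t + 2) / (up t ^ 2 - 1) \<and>
        lam t > 0 \<and> mu t > 0)"

definition cy_omega :: "(real \<Rightarrow> real) \<Rightarrow> (real \<Rightarrow> real) \<Rightarrow> real \<Rightarrow> tvec list \<Rightarrow> real" where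
  "cy_omega up lam t xs =
     wedge11 dt (\<lambda>ys. lam t * eta_se ys) xs + ((-1) * omega0_se xs + up t * omega1_se xs)"

definition cy_Omega :: "(real \<Rightarrow> real) \<Rightarrow> (real \<Rightarrow> real) \<Rightarrow> real \<Rightarrow> tvec list \<Rightarrow> complex" where
  "cy_Omega lam mu t =
     wedge (*) 1
       (\<lambda>ys. complex_of_real (dt ys) + \<i> * complex_of_real (lam t * eta_se ys))
       (\<lambda>ys. complex_of_real (mu t * omega2_se ys) + \<i> * complex_of_real (mu t * omega3_se ys))"


section \<open>Invariant connections and instantons away from the zero section\<close>

type_synonym conn = "real \<Rightarrow> tvec \<Rightarrow> mat2"

definition frame :: "tvec set" where
  "frame = {(1, 0, 0), (0, E1, 0), (0, E2, 0), (0, E3, 0), (0, 0, E1), (0, 0, E2), (0, 0, E3)}"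

definition tlie :: "tvec \<Rightarrow> tvec \<Rightarrow> tvec" where
  "tlie = (\<lambda>(s, X, Y) (s', X', Y'). (0, lie X X', lie Y Y'))"

(* F = dA + [A, A]/2 by Cartan's formula, with the arguments extended to vector fields with
   constant coefficients in the left-invariant frame. *)
definition curvature :: "conn \<Rightarrow> real \<Rightarrow> tvec list \<Rightarrow> mat2" where
  "curvature A t xs = (let x = xs ! 0; y = xs ! 1 in
     fst x *\<^sub>R vector_derivative (\<lambda>s. A s y) (at t)
     - fst y *\<^sub>R vector_derivative (\<lambda>s. A s x) (at t)
     - A t (tlie x y) + lie (A t x) (A t y))"

definition instanton ::
    "(real \<Rightarrow> real) \<Rightarrow> (real \<Rightarrow> real) \<Rightarrow> (real \<Rightarrow> real) \<Rightarrow> conn \<Rightarrow> bool" where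
  "instanton up lam mu A \<longleftrightarrow>
     (\<forall>x\<in>tangent. smooth_on (\<lambda>t. A t x) {0<..}) \<and>
     (\<forall>t>0. \<forall>xs. set xs \<subseteq> tangent \<longrightarrow>
        (length xs = 6 \<longrightarrow>
           wedge (\<lambda>M r. r *\<^sub>R M) 2 (curvature A t)
             (wedge (*) 2 (cy_omega up lam t) (cy_omega up lam t)) xs = 0) \<and>
        (length xs = 5 \<longrightarrow>
           wedge (\<lambda>M r. r *\<^sub>R M) 2 (curvature A t)
             (\<lambda>ys. Re (cy_Omega lam mu t ys)) xs = 0))"

definition conn_form :: "(real \<Rightarrow> real) \<Rightarrow> (real \<Rightarrow> real) \<Rightarrow> conn" where
  "conn_form a0 a2 t x =
     a2 t *\<^sub>R (v2 [x] *\<^sub>R E2 + w2 [x] *\<^sub>R E3) + (a0 t * u_minus [x]) *\<^sub>R E1 + u_plus [x] *\<^sub>R E1"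

(* pull-back under (t, g) \<mapsto> (\<delta> t, g), i.e. under fibrewise multiplication by \<delta> *)
definition pullback_scale :: "real \<Rightarrow> conn \<Rightarrow> conn" where
  "pullback_scale \<delta> A = (\<lambda>t (s, X, Y). A (\<delta> * t) (\<delta> * s, X, Y))"

definition conn_converges_on :: "real set \<Rightarrow> (real \<Rightarrow> conn) \<Rightarrow> conn \<Rightarrow> bool" where
  "conn_converges_on S A L \<longleftrightarrow>
     (\<forall>x\<in>frame. uniform_limit S (\<lambda>\<epsilon> t. A \<epsilon> t x) (\<lambda>t. L t x) at_top)"


section \<open>The fibre and extension over the zero section\<close>

(* The quaternions are the matrices x1 + x2 E1 + x3 E2 + x4 E3, with i, j, k = E1, E2, E3. *)
definition quat :: "real^4 \<Rightarrow> mat2" where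
  "quat x = x $ 1 *\<^sub>R mat 1 + x $ 2 *\<^sub>R E1 + x $ 3 *\<^sub>R E2 + x $ 4 *\<^sub>R E3"

definition unquat :: "mat2 \<Rightarrow> real^4" where
  "unquat M = (\<chi> i. if i = 1 then Re (M $ 1 $ 1) else if i = 2 then Im (M $ 1 $ 1)
     else if i = 3 then Re (M $ 1 $ 2) else Im (M $ 1 $ 2))"

lemma unquat_quat: "unquat (quat x) = x"
  by (simp add: unquat_def quat_def E1_def E2_def E3_def mat_def vec_eq_iff[of _ x] forall_4)

(* U(1) x SU(2) as a subgroup of SU(2)^2, with exp(i\<theta>) embedded as
   diag (exp(i\<theta>), exp(-i\<theta>)), together with its Lie algebra *)
definition isoK :: "(mat2 \<times> mat2) set" where
  "isoK = {vector [vector [cis \<theta>, 0], vector [0, cis (- \<theta>)]] | \<theta>. True} \<times> SU2"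

definition liek :: "(mat2 \<times> mat2) set" where
  "liek = range (\<lambda>s. s *\<^sub>R E1) \<times> su2"

(* (exp(i\<theta>), q) v = q v exp(-i\<theta>) and its derivative *)
definition act :: "mat2 \<times> mat2 \<Rightarrow> real^4 \<Rightarrow> real^4" where
  "act = (\<lambda>(D, q) x. unquat (q ** quat x ** cadj D))"

definition iact :: "mat2 \<times> mat2 \<Rightarrow> real^4 \<Rightarrow> real^4" where
  "iact = (\<lambda>(X, Y) x. unquat (Y ** quat x - quat x ** X))"

(* The isotropy homomorphism of P_{0,Id}. Being the restriction of a linear map, it is also
   its own derivative. *)
definition iso_0Id :: "mat2 \<times> mat2 \<Rightarrow> mat2" where
  "iso_0Id = snd"

(* An invariant connection on SU(2)^2 x_K (H x SU(2)), where K acts on SU(2) through h and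
   k (g, x, p) = (g k^{-1}, k x, h(k) p). Pulled back to the trivial bundle over SU(2)^2 x H it is
   a left-invariant 1-form B x (X, Y, w), with X + Y a left-invariant vector field on
   SU(2)^2 and w tangent to H at x. The last two conditions say that the connection form
   descends along the K-action: it is K-invariant and vanishes on the K-orbits, whose tangent
   vectors are (- \<xi>, iact \<xi> x, h \<xi>). *)
definition inv_connection ::
    "(mat2 \<times> mat2 \<Rightarrow> mat2) \<Rightarrow> (real^4 \<Rightarrow> mat2 \<times> mat2 \<times> (real^4) \<Rightarrow> mat2) \<Rightarrow> bool" where
  "inv_connection h B \<longleftrightarrow>
     (\<forall>x. linear (B x)) \<and>
     (\<forall>X\<in>su2. \<forall>Y\<in>su2. \<forall>w. (\<forall>x. B x (X, Y, w) \<in> su2) \<and> smooth_on (\<lambda>x. B x (X, Y, w)) UNIV) \<and>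
     (\<forall>(D, q)\<in>isoK. \<forall>X\<in>su2. \<forall>Y\<in>su2. \<forall>x w.
        B (act (D, q) x) (D ** X ** cadj D, q ** Y ** cadj q, act (D, q) w) =
          h (D, q) ** B x (X, Y, w) ** cadj (h (D, q))) \<and>
     (\<forall>(X, Y)\<in>liek. \<forall>x. B x (X, Y, 0) = B x (0, 0, iact (X, Y) x) + h (X, Y))"

(* The point (t, g) of the complement of the zero section is the class of (g, t) in SU(2)^2 x_K H. *)
definition on_complement :: "(real^4 \<Rightarrow> mat2 \<times> mat2 \<times> (real^4) \<Rightarrow> mat2) \<Rightarrow> conn" where
  "on_complement B t = (\<lambda>(s, X, Y). B (t *\<^sub>R axis 1 1) (X, Y, s *\<^sub>R axis 1 1))"

definition extends_smoothly :: "(mat2 \<times> mat2 \<Rightarrow> mat2) \<Rightarrow> conn \<Rightarrow> bool" where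
  "extends_smoothly h A \<longleftrightarrow>
     (\<exists>B. inv_connection h B \<and> (\<forall>t>0. \<forall>x\<in>tangent. A t x = on_complement B t x))"


section \<open>Anti-self-dual connections on the fibre and their lifts\<close>

type_synonym conn4 = "real^4 \<Rightarrow> real^4 \<Rightarrow> mat2"

definition su2_conn4 :: "conn4 \<Rightarrow> bool" where
  "su2_conn4 \<alpha> \<longleftrightarrow> (\<forall>x. linear (\<alpha> x) \<and> range (\<alpha> x) \<subseteq> su2) \<and> (\<forall>w. smooth_on (\<lambda>x. \<alpha> x w) UNIV)"

definition curvature4 :: "conn4 \<Rightarrow> real^4 \<Rightarrow> real^4 \<Rightarrow> real^4 \<Rightarrow> mat2" where
  "curvature4 \<alpha> x v w =
     frechet_derivative (\<lambda>y. \<alpha> y w) (at x) v - frechet_derivative (\<lambda>y. \<alpha> y v) (at x) w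
     + lie (\<alpha> x v) (\<alpha> x w)"

definition flat4 :: "conn4 \<Rightarrow> bool" where
  "flat4 \<alpha> \<longleftrightarrow> (\<forall>x v w. curvature4 \<alpha> x v w = 0)"

(* *F = -F in components with respect to a positively oriented orthonormal basis *)
definition asd_wrt ::
    "real^4 \<Rightarrow> real^4 \<Rightarrow> real^4 \<Rightarrow> real^4 \<Rightarrow> (real^4 \<Rightarrow> real^4 \<Rightarrow> mat2) \<Rightarrow> bool" where
  "asd_wrt e0 e1 e2 e3 F \<longleftrightarrow>
     F e0 e1 = - F e2 e3 \<and> F e0 e2 = - F e3 e1 \<and> F e0 e3 = - F e1 e2"

(* The fibre H is C^2 with complex structure given by right multiplication by -i (U(1) acts
   on the right, SU(2) on the left). It is oriented as a complex vector space: the basis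
   1, i, j, -k is positive, and 1, i, j, k is negative. Indeed, to leading order at t = 0,
   \<omega> restricts to the fibre as - dx1 \<and> dx2 + dx3 \<and> dx4. *)
definition asd4 :: "conn4 \<Rightarrow> bool" where
  "asd4 \<alpha> \<longleftrightarrow> (\<forall>x. asd_wrt (axis 1 1) (axis 2 1) (axis 3 1) (- axis 4 1) (curvature4 \<alpha> x))"

definition equivariant4 :: "(mat2 \<times> mat2 \<Rightarrow> mat2) \<Rightarrow> conn4 \<Rightarrow> bool" where
  "equivariant4 h \<alpha> \<longleftrightarrow>
     (\<forall>k\<in>isoK. \<forall>x w. \<alpha> (act k x) (act k w) = h k ** \<alpha> x w ** cadj (h k))"

(* The invariant connection restricting to \<alpha> on each fibre and to the canonical connection of
   SU(2)^2 -> CP^1 (with horizontal space spanned by (E2, 0), (E3, 0)) in the other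
   directions: (X, Y) acts through its component (coE1 X E1, Y) in the Lie algebra of K. *)
definition lift4 ::
    "(mat2 \<times> mat2 \<Rightarrow> mat2) \<Rightarrow> conn4 \<Rightarrow> real^4 \<Rightarrow> mat2 \<times> mat2 \<times> (real^4) \<Rightarrow> mat2" where
  "lift4 h \<alpha> x = (\<lambda>(X, Y, w).
     let \<xi> = (coE1 X *\<^sub>R E1, Y) in \<alpha> x (w + iact \<xi> x) + h \<xi>)"


section \<open>The family of instantons and bubbling\<close>

definition is_R :: "(real \<Rightarrow> real) \<Rightarrow> (real \<Rightarrow> real) \<Rightarrow> (real \<Rightarrow> real) \<Rightarrow> real \<Rightarrow>
    (real \<Rightarrow> real) \<Rightarrow> (real \<Rightarrow> real) \<Rightarrow> bool" where
  "is_R up lam mu \<epsilon> a0 a2 \<longleftrightarrow>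
     instanton up lam mu (conn_form a0 a2) \<and>
     extends_smoothly iso_0Id (conn_form a0 a2) \<and>
     (\<lambda>t. a0 t - (-1 + \<epsilon> * t ^ 2)) \<in> O[at_right 0](\<lambda>t. t ^ 4) \<and>
     (\<lambda>t. a2 t - (1 - 1/2 * \<epsilon> * t ^ 2)) \<in> O[at_right 0](\<lambda>t. t ^ 4)"

definition R'0 :: "(real \<Rightarrow> real) \<Rightarrow> conn" where
  "R'0 up = conn_form (\<lambda>t. 2 / (up t + 1)) (\<lambda>t. 0)"

(* Convergence is uniform on (0, T], that is, on compact neighbourhoods of the zero section. *)
definition bubbles_asd :: "(real \<Rightarrow> conn) \<Rightarrow> bool" where
  "bubbles_asd R \<longleftrightarrow>
     (\<exists>\<delta> \<alpha>. (\<forall>\<epsilon>>0. \<delta> \<epsilon> > 0) \<and> (\<delta> \<longlongrightarrow> 0) at_top \<and>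
        su2_conn4 \<alpha> \<and> equivariant4 iso_0Id \<alpha> \<and> asd4 \<alpha> \<and> \<not> flat4 \<alpha> \<and>
        (\<forall>T>0. conn_converges_on {0<..T} (\<lambda>\<epsilon>. pullback_scale (\<delta> \<epsilon>) (R \<epsilon>))
           (on_complement (lift4 iso_0Id \<alpha>))))"

end

theory Submission
  imports Defs
begin

text \<open>Put \<open>s = u\<^sub>1 - 1\<close>, \<open>p = a0 + 1\<close> and \<open>c = a2\<close>. The instanton equations become
\<open>dp/ds = 2 (1 - c\<^sup>2) / s - 2 (1 + s) / (s (s + 2)) p\<close> and \<open>dc/ds = - 3 (s + 2) / (4 s (s + 3)) c p\<close>
(\<open>instanton_odes\<close>, \<open>is_R_radial_instanton\<close>), and the parameter \<open>\<epsilon>\<close> enters only through the slopes of \<open>p\<close>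
and \<open>c\<close> at \<open>s = 0\<close>.

For small \<open>s\<close> the leading part of this system is invariant under scaling of \<open>s\<close>. It has the solutions
\<open>c = 1 / (1 + \<epsilon> s / 3)\<close>, \<open>p = 2 (1 - c)\<close>, and as \<open>s\<close> is asymptotic to \<open>3/2 t\<^sup>2\<close>, these are the lifts of
the basic instanton on the fibres, at scale \<open>sqrt (2 / \<epsilon>)\<close> (\<open>curvature4_bpst\<close>, \<open>lift_bpst\<close>). What has to be
shown is that the true solution stays close to this one uniformly in \<open>\<epsilon>\<close>. Two facts achieve this. First,
the defect \<open>E = 2 (1 - c) - p\<close> satisfies \<open>0 \<le> E \<le> 2/3 s (1 - c)\<close>, because it solves a linear equation
with a damping term and a small source (\<open>p_le\<close>, \<open>p_ge\<close>). Secondly, in the variable \<open>z = (1 - c) / c\<close> the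
model solution is linear, and the bounds on \<open>E\<close> turn into
\<open>\<epsilon>/3 s exp (- s/2) \<le> z \<le> \<epsilon>/3 s exp (s/6)\<close> for all \<open>s\<close> and \<open>\<epsilon>\<close> (\<open>z_ge\<close>, \<open>z_le\<close>).

Both parts of the theorem are read off. On the scale \<open>t = t' / sqrt \<epsilon>\<close> the variable \<open>s\<close> tends to \<open>0\<close>,
so \<open>z\<close> tends to \<open>t'\<^sup>2 / 2\<close> and \<open>c\<close>, \<open>p\<close> tend to the coefficients of the basic instanton
(\<open>z_near_quadratic\<close>, \<open>near_bpst\<close>). At a fixed positive distance \<open>z\<close> grows like \<open>\<epsilon>\<close>, so \<open>c\<close> is of order
\<open>1/\<epsilon>\<close>; then the flux \<open>s (s + 2) p\<close>, whose derivative is \<open>2 (s + 2) (1 - c\<^sup>2)\<close>, is within \<open>O(1/\<epsilon>)\<close> of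
\<open>s\<^sup>2 + 4 s\<close>, and \<open>a0 = p - 1\<close> tends to \<open>2 / (s + 2) = 2 / (u\<^sub>1 + 1)\<close> (\<open>c_le\<close>, \<open>p_near_abelian\<close>).\<close>

section \<open>Wedge products on explicit vectors\<close>

lemma wedge_0: "wedge m 0 \<alpha> \<beta> xs = m (\<alpha> []) (\<beta> xs)"
proof -
  have "{I. I \<subseteq> {..<length xs} \<and> card I = 0} = {{}}"
    by (auto dest: finite_subset)
  then show ?thesis by (simp add: wedge_def nths_all)
qed

lemma wedge_Nil: "wedge m (Suc k) \<alpha> \<beta> [] = 0"
proof -
  have "{I. I \<subseteq> {..<0::nat} \<and> card I = Suc k} = {}" by auto
  then show ?thesis unfolding wedge_def list.size by (simp only: sum.empty)
qed

text \<open>A shuffle either passes the first vector to the left factor, which costs no inversion, or it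
passes it to the right factor, where it is overtaken by every vector of the left factor. This
recursion evaluates a wedge product on an explicit list of vectors without enumerating sets of
positions.\<close>
lemma wedge_Cons:
  "wedge m (Suc k) \<alpha> \<beta> (x # xs) =
     wedge m k (\<lambda>ys. \<alpha> (x # ys)) \<beta> xs
     + (-1) ^ Suc k *\<^sub>R wedge m (Suc k) \<alpha> (\<lambda>ys. \<beta> (x # ys)) xs"
proof -
  define n where "n = length xs"
  define S where "S j = {I. I \<subseteq> {..<n} \<and> card I = j}" for j
  define inv where "inv N I = {(i, j). i \<in> I \<and> j < N \<and> j \<notin> I \<and> j < i}" for N :: nat and I :: "nat set"
  define T where "T I = (-1) ^ card (inv (Suc n) I) *\<^sub>R
    m (\<alpha> (nths (x # xs) I)) (\<beta> (nths (x # xs) (- I)))" for I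
  let ?f = "\<lambda>I. insert 0 (Suc ` I)"
  have fin: "finite I" if "I \<in> S j" for I j
    using that by (auto simp: S_def dest: finite_subset)
  have finS: "finite (S j)" for j by (simp add: S_def)
  have split: "{I. I \<subseteq> {..<length (x # xs)} \<and> card I = Suc k} = ?f ` S k \<union> (`) Suc ` S (Suc k)"
    (is "?L = ?R")
  proof (intro equalityI subsetI)
    fix I assume I: "I \<in> ?L"
    define J where "J = {j. Suc j \<in> I}"
    have fI: "finite I" using I by (auto dest: finite_subset)
    have IJ: "I = (if 0 \<in> I then ?f J else Suc ` J)"
      proof (intro set_eqI)
      fix i show "i \<in> I \<longleftrightarrow> i \<in> (if 0 \<in> I then ?f J else Suc ` J)"
        by (cases i) (auto simp: J_def)
    qed
    have J: "J \<subseteq> {..<n}" using I by (auto simp: J_def n_def)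
    then have fJ: "finite J" by (auto dest: finite_subset)
    show "I \<in> ?R"
    proof (cases "0 \<in> I")
      case True
      then have e: "I = ?f J" using IJ by simp
      have "card I = Suc (card J)" unfolding e using fJ
        by (subst card_insert_disjoint) (auto simp: card_image)
      then have "J \<in> S k" using I J by (simp add: S_def)
      then show ?thesis using e by blast
    next
      case False
      then have e: "I = Suc ` J" using IJ by simp
      have "card I = card J" unfolding e by (simp add: card_image)
      then have "J \<in> S (Suc k)" using I J by (simp add: S_def)
      then show ?thesis using e by blast
    qed
  next
    fix I assume "I \<in> ?R"
    then consider J where "J \<in> S k" "I = ?f J" | J where "J \<in> S (Suc k)" "I = Suc ` J" by blast
    then show "I \<in> ?L"
    proof cases
      case 1
      then show ?thesis using fin[OF 1(1)]
        by (auto simp: S_def n_def card_insert_disjoint card_image)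
    next
      case 2
      then show ?thesis by (auto simp: S_def n_def card_image)
    qed
  qed
  have inj1: "inj_on ?f (S k)"
  proof (rule inj_onI)
    fix I J assume "?f I = ?f J"
    then show "I = J" by (auto simp: set_eq_iff image_iff)
  qed
  have inj2: "inj_on ((`) Suc) (S (Suc k))"
    by (rule inj_onI) (simp add: inj_image_eq_iff)
  have inv1: "card (inv (Suc n) (?f I)) = card (inv n I)" for I
  proof -
    have "inv (Suc n) (?f I) = map_prod Suc Suc ` inv n I"
    proof (intro equalityI subsetI)
      fix y assume "y \<in> inv (Suc n) (?f I)"
      then obtain i j where y: "y = (i, j)" and h: "i \<in> ?f I" "j < Suc n" "j \<notin> ?f I" "j < i"
        by (auto simp: inv_def)
      from h obtain i' j' where "i = Suc i'" "j = Suc j'" by (cases i; cases j; simp)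
      with h y show "y \<in> map_prod Suc Suc ` inv n I" by (auto simp: inv_def)
    qed (auto simp: inv_def)
    then show ?thesis by (simp add: card_image prod.inj_map inj_on_subset[OF _ subset_UNIV])
  qed
  have inv2: "card (inv (Suc n) (Suc ` I)) = card (inv n I) + Suc k" if I: "I \<in> S (Suc k)" for I
  proof -
    have eq: "inv (Suc n) (Suc ` I) = map_prod Suc Suc ` inv n I \<union> (\<lambda>i. (Suc i, 0)) ` I"
    proof (intro equalityI subsetI)
      fix y assume "y \<in> inv (Suc n) (Suc ` I)"
      then obtain i j where y: "y = (Suc i, j)" and h: "i \<in> I" "j < Suc n" "j \<notin> Suc ` I" "j < Suc i"
        by (auto simp: inv_def)
      then show "y \<in> map_prod Suc Suc ` inv n I \<union> (\<lambda>i. (Suc i, 0)) ` I"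
        by (cases j) (auto simp: inv_def)
    qed (auto simp: inv_def)
    have "inv n I \<subseteq> I \<times> {..<n}" by (auto simp: inv_def)
    then have f: "finite (inv n I)" using fin[OF I] by (auto dest: finite_subset)
    have "card (inv (Suc n) (Suc ` I)) = card (map_prod Suc Suc ` inv n I) + card ((\<lambda>i. (Suc i, 0::nat)) ` I)"
      unfolding eq using f fin[OF I] by (intro card_Un_disjoint) auto
    also have "card (map_prod Suc Suc ` inv n I) = card (inv n I)"
      by (simp add: card_image prod.inj_map inj_on_subset[OF _ subset_UNIV])
    also have "card ((\<lambda>i. (Suc i, 0::nat)) ` I) = card I"
      by (rule card_image) (auto simp: inj_on_def)
    finally show ?thesis using I by (simp add: S_def)
  qed
  have "wedge m (Suc k) \<alpha> \<beta> (x # xs) = sum T (?f ` S k \<union> (`) Suc ` S (Suc k))"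
    unfolding wedge_def split by (simp add: T_def inv_def n_def)
  also have "\<dots> = sum T (?f ` S k) + sum T ((`) Suc ` S (Suc k))"
    by (rule sum.union_disjoint) (auto simp: finS)
  also have "sum T (?f ` S k) = (\<Sum>I\<in>S k. T (?f I))"
    by (rule sum.reindex_cong[OF inj1]) auto
  also have "\<dots> = wedge m k (\<lambda>ys. \<alpha> (x # ys)) \<beta> xs"
    unfolding wedge_def
  proof (rule sum.cong)
    fix I assume "I \<in> {I. I \<subseteq> {..<length xs} \<and> card I = k}"
    have "{j. Suc j \<in> ?f I} = I" "{j. Suc j \<in> - ?f I} = - I" by auto
    then show "T (?f I) = (- 1) ^ card {(i, j). i \<in> I \<and> j < length xs \<and> j \<notin> I \<and> j < i} *\<^sub>R
        m (\<alpha> (x # nths xs I)) (\<beta> (nths xs (- I)))"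
      by (simp add: T_def inv1 nths_Cons) (simp add: inv_def n_def)
  qed (simp add: S_def n_def)
  also have "sum T ((`) Suc ` S (Suc k)) = (\<Sum>I\<in>S (Suc k). T (Suc ` I))"
    by (rule sum.reindex_cong[OF inj2]) auto
  also have "\<dots> = (-1) ^ Suc k *\<^sub>R wedge m (Suc k) \<alpha> (\<lambda>ys. \<beta> (x # ys)) xs"
    unfolding wedge_def scaleR_sum_right
  proof (rule sum.cong)
    fix I assume I: "I \<in> {I. I \<subseteq> {..<length xs} \<and> card I = Suc k}"
    then have "I \<in> S (Suc k)" by (simp add: S_def n_def)
    note c = inv2[OF this]
    have "{j. Suc j \<in> Suc ` I} = I" "{j. Suc j \<in> - Suc ` I} = - I" by auto
    then have "T (Suc ` I) = (-1) ^ (card (inv n I) + Suc k) *\<^sub>R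
        m (\<alpha> (nths xs I)) (\<beta> (x # nths xs (- I)))"
      unfolding T_def c by (simp add: nths_Cons)
    then show "T (Suc ` I) = (-1) ^ Suc k *\<^sub>R ((- 1) ^ card {(i, j). i \<in> I \<and> j < length xs \<and> j \<notin> I \<and> j < i} *\<^sub>R
        m (\<alpha> (nths xs I)) (\<beta> (x # nths xs (- I))))"
      by (simp add: inv_def n_def power_add mult.commute)
  qed (simp add: S_def n_def)
  finally show ?thesis .
qed

lemmas wedge_simps = wedge_0 wedge_Nil wedge_Cons

lemma wedge_1_2: "wedge m (Suc 0) F G [a, b] = m (F [a]) (G [b]) - m (F [b]) (G [a])"
  by (simp add: wedge_simps)

lemma wedge_1_3:
  "wedge m (Suc 0) F G [a, b, c] = m (F [a]) (G [b, c]) - m (F [b]) (G [a, c]) + m (F [c]) (G [a, b])"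
  by (simp add: wedge_simps)

lemma wedge_2_4:
  "wedge m 2 F G [a, b, c, d] =
     m (F [a, b]) (G [c, d]) - m (F [a, c]) (G [b, d]) + m (F [a, d]) (G [b, c])
     + m (F [b, c]) (G [a, d]) - m (F [b, d]) (G [a, c]) + m (F [c, d]) (G [a, b])"
  by (simp add: wedge_simps numeral_2_eq_2)

lemma wedge_2_5:
  "wedge m 2 F G [a, b, c, d, e] =
     m (F [a, b]) (G [c, d, e]) - m (F [a, c]) (G [b, d, e]) + m (F [a, d]) (G [b, c, e])
     - m (F [a, e]) (G [b, c, d]) + m (F [b, c]) (G [a, d, e]) - m (F [b, d]) (G [a, c, e])
     + m (F [b, e]) (G [a, c, d]) + m (F [c, d]) (G [a, b, e]) - m (F [c, e]) (G [a, b, d])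
     + m (F [d, e]) (G [a, b, c])"
  by (simp add: wedge_simps numeral_2_eq_2)

lemma wedge_2_6:
  "wedge m 2 F G [a, b, c, d, e, f] =
     m (F [a, b]) (G [c, d, e, f]) - m (F [a, c]) (G [b, d, e, f]) + m (F [a, d]) (G [b, c, e, f])
     - m (F [a, e]) (G [b, c, d, f]) + m (F [a, f]) (G [b, c, d, e]) + m (F [b, c]) (G [a, d, e, f])
     - m (F [b, d]) (G [a, c, e, f]) + m (F [b, e]) (G [a, c, d, f]) - m (F [b, f]) (G [a, c, d, e])
     + m (F [c, d]) (G [a, b, e, f]) - m (F [c, e]) (G [a, b, d, f]) + m (F [c, f]) (G [a, b, d, e])
     + m (F [d, e]) (G [a, b, c, f]) - m (F [d, f]) (G [a, b, c, e]) + m (F [e, f]) (G [a, b, c, d])"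
  by (simp add: wedge_simps numeral_2_eq_2)

section \<open>The instanton equations as differential equations\<close>

lemma coE_simps [simp]:
  "coE1 0 = 0" "coE2 0 = 0" "coE3 0 = 0"
  "coE1 (- X) = - coE1 X" "coE2 (- X) = - coE2 X" "coE3 (- X) = - coE3 X"
  "coE1 (r *\<^sub>R X) = r * coE1 X" "coE2 (r *\<^sub>R X) = r * coE2 X" "coE3 (r *\<^sub>R X) = r * coE3 X"
  "coE1 (X + Y) = coE1 X + coE1 Y" "coE1 (X - Y) = coE1 X - coE1 Y"
  "coE2 (X + Y) = coE2 X + coE2 Y" "coE2 (X - Y) = coE2 X - coE2 Y"
  "coE1 E1 = 1" "coE1 E2 = 0" "coE1 E3 = 0"
  "coE2 E1 = 0" "coE2 E2 = 1" "coE2 E3 = 0"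
  "coE3 E1 = 0" "coE3 E2 = 0" "coE3 E3 = 1"
  by (simp_all add: coE1_def coE2_def coE3_def E1_def E2_def E3_def)

lemma coframe_simps [simp]:
  "dt [(s, X, Y)] = s"
  "u1 [(s, X, Y)] = coE1 X" "v1 [(s, X, Y)] = coE2 X" "w1 [(s, X, Y)] = coE3 X"
  "u2 [(s, X, Y)] = coE1 Y" "v2 [(s, X, Y)] = coE2 Y" "w2 [(s, X, Y)] = coE3 Y"
  "u_plus [(s, X, Y)] = (coE1 X + coE1 Y) / 2" "u_minus [(s, X, Y)] = (coE1 X - coE1 Y) / 2"
  "eta_se [(s, X, Y)] = 2/3 * (coE1 X - coE1 Y)"
  by (simp_all add: dt_def u1_def v1_def w1_def u2_def v2_def w2_def u_plus_def u_minus_def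
      eta_se_def form1_def)

lemma lie_skew: "lie Y X = - lie X Y"
  by (simp add: lie_def)

lemma mat2_mult_nth: "((A :: mat2) ** B) $ i $ j = A $ i $ 1 * B $ 1 $ j + A $ i $ 2 * B $ 2 $ j"
  by (simp add: matrix_matrix_mult_def sum_2)

lemma matrix_minus_left: "(- A :: mat2) ** (B :: mat2) = - (A ** B)"
  by (simp add: mat2_eq mat2_mult_nth)

lemma matrix_minus_right: "(A :: mat2) ** (- B :: mat2) = - (A ** B)"
  by (simp add: mat2_eq mat2_mult_nth)

lemma matrix_scaleR_left: "(r *\<^sub>R A :: mat2) ** (B :: mat2) = r *\<^sub>R (A ** B)"
  by (simp add: mat2_eq mat2_mult_nth algebra_simps)

lemma matrix_scaleR_right: "(A :: mat2) ** (r *\<^sub>R B :: mat2) = r *\<^sub>R (A ** B)"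
  by (simp add: mat2_eq mat2_mult_nth algebra_simps)

lemma lie_linear [simp]:
  "lie X X = 0" "lie X 0 = 0" "lie 0 X = 0"
  "lie (- X) Y = - lie X Y" "lie X (- Y) = - lie X Y"
  "lie (r *\<^sub>R X) Y = r *\<^sub>R lie X Y" "lie X (r *\<^sub>R Y) = r *\<^sub>R lie X Y"
  by (simp_all add: lie_def matrix_minus_left matrix_minus_right matrix_scaleR_left
      matrix_scaleR_right algebra_simps)

lemma lie_E_rev [simp]: "lie E2 E1 = - 2 *\<^sub>R E3" "lie E3 E2 = - 2 *\<^sub>R E1" "lie E1 E3 = - 2 *\<^sub>R E2"
  unfolding lie_skew[of E2 E1] lie_skew[of E3 E2] lie_skew[of E1 E3] lie_E by simp_all

lemma tlie_pair: "tlie (s, X, Y) (s', X', Y') = (0, lie X X', lie Y Y')"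
  by (simp add: tlie_def)

text \<open>A frame of the tangent space of the quotient. The vector \<open>e_u\<close> is normalised by
\<open>u\<^sup>-(e_u) = 1\<close> and \<open>u\<^sup>+(e_u) = 0\<close>, so that it is transverse to the diagonal circle.\<close>
definition d_t :: tvec where "d_t = (1, 0, 0)"
definition e_u :: tvec where "e_u = (0, E1, - E1)"
definition e_v1 :: tvec where "e_v1 = (0, E2, 0)"
definition e_w1 :: tvec where "e_w1 = (0, E3, 0)"
definition e_v2 :: tvec where "e_v2 = (0, 0, E2)"
definition e_w2 :: tvec where "e_w2 = (0, 0, E3)"
lemmas e_defs = d_t_def e_u_def e_v1_def e_w1_def e_v2_def e_w2_def

lemma E_nonzero: "E1 \<noteq> 0" "E2 \<noteq> 0" "E3 \<noteq> 0"
  by (simp_all add: mat2_eq E1_def E2_def E3_def)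

lemma su2_uminus: "- E1 \<in> su2"
  by (simp add: su2_def cadj_def E1_def trace_def sum_2 mat2_eq)

lemma zero_su2: "0 \<in> su2"
  by (simp add: su2_def cadj_def trace_def mat2_eq)

lemma e_tangent: "d_t \<in> tangent" "e_u \<in> tangent" "e_v1 \<in> tangent" "e_w1 \<in> tangent"
   "e_v2 \<in> tangent" "e_w2 \<in> tangent"
  by (simp_all add: e_defs tangent_def E_in_su2 su2_uminus zero_su2)

text \<open>From \<open>du = -2 v \<and> w\<close> and its cyclic permutations one gets
\<open>F = E1 (a0' dt \<and> u\<^sup>- - (a0 + 1) v1 \<and> w1 + (a0 - 1 + 2 a2\<^sup>2) v2 \<and> w2)
  + E2 (a2' dt \<and> v2 + 2 a2 (a0 + 1) w2 \<and> u\<^sup>-) + E3 (a2' dt \<and> w2 - 2 a2 (a0 + 1) v2 \<and> u\<^sup>-)\<close>.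
The components listed here are those that meet a non-zero component of \<open>\<omega>\<^sup>2\<close> or \<open>Re \<Omega>\<close> on the vectors
chosen in the derivation of the differential equations.\<close>
lemma curvature_conn_form:
  assumes "(a0 has_real_derivative a0') (at t)" "(a2 has_real_derivative a2') (at t)"
  shows "curvature (conn_form a0 a2) t [d_t, e_u] = a0' *\<^sub>R E1"
    "curvature (conn_form a0 a2) t [e_v1, e_w1] = - (a0 t + 1) *\<^sub>R E1"
    "curvature (conn_form a0 a2) t [e_v2, e_w2] = (a0 t - 1 + 2 * (a2 t)\<^sup>2) *\<^sub>R E1"
    "curvature (conn_form a0 a2) t [d_t, e_v2] = a2' *\<^sub>R E2"
    "curvature (conn_form a0 a2) t [e_u, e_w2] = - (2 * a2 t * (a0 t + 1)) *\<^sub>R E2"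
proof -
  have d: "vector_derivative (\<lambda>s. conn_form a0 a2 s y) (at t) =
      a2' *\<^sub>R (v2 [y] *\<^sub>R E2 + w2 [y] *\<^sub>R E3) + (a0' * u_minus [y]) *\<^sub>R E1" for y
    unfolding conn_form_def
    by (rule vector_derivative_at) (use assms in \<open>auto intro!: derivative_eq_intros\<close>)
  show "curvature (conn_form a0 a2) t [d_t, e_u] = a0' *\<^sub>R E1"
    "curvature (conn_form a0 a2) t [e_v1, e_w1] = - (a0 t + 1) *\<^sub>R E1"
    "curvature (conn_form a0 a2) t [e_v2, e_w2] = (a0 t - 1 + 2 * (a2 t)\<^sup>2) *\<^sub>R E1"
    "curvature (conn_form a0 a2) t [d_t, e_v2] = a2' *\<^sub>R E2"
    "curvature (conn_form a0 a2) t [e_u, e_w2] = - (2 * a2 t * (a0 t + 1)) *\<^sub>R E2"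
    unfolding curvature_def Let_def d
    by (simp_all add: e_defs tlie_pair conn_form_def lie_E algebra_simps power2_eq_square
        flip: scaleR_add_left)
qed

lemmas cy_values = cy_omega_def omega0_se_def omega1_se_def omega2_se_def omega3_se_def wedge_1_2

lemma cy_omega_values:
  "cy_omega up lam t [d_t, e_u] = 4/3 * lam t"
  "cy_omega up lam t [e_v1, e_w1] = - (2/3) * (up t + 1)"
  "cy_omega up lam t [e_v2, e_w2] = 2/3 * (up t - 1)"
  "cy_omega up lam t [d_t, e_v1] = 0" "cy_omega up lam t [d_t, e_w1] = 0"
  "cy_omega up lam t [d_t, e_v2] = 0" "cy_omega up lam t [d_t, e_w2] = 0"
  "cy_omega up lam t [e_u, e_v1] = 0" "cy_omega up lam t [e_u, e_w1] = 0"
  "cy_omega up lam t [e_u, e_v2] = 0" "cy_omega up lam t [e_u, e_w2] = 0"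
  "cy_omega up lam t [e_v1, e_v2] = 0" "cy_omega up lam t [e_v1, e_w2] = 0"
  "cy_omega up lam t [e_w1, e_v2] = 0" "cy_omega up lam t [e_w1, e_w2] = 0"
  by (simp_all add: cy_values e_defs algebra_simps)

text \<open>The coefficient of \<open>E1\<close> in \<open>F \<and> \<omega>\<^sup>2 = 0\<close> is the equation for \<open>a0\<close>, and the coefficient of \<open>E2\<close> in
\<open>F \<and> Re \<Omega> = 0\<close> is the equation for \<open>a2\<close>.\<close>
lemma instanton_odes:
  assumes inst: "instanton up lam mu (conn_form a0 a2)" and t: "t > 0"
    and d0: "(a0 has_real_derivative a0') (at t)" and d2: "(a2 has_real_derivative a2') (at t)"
    and pos: "up t > 1" "lam t > 0" "mu t > 0"
  shows "a0' * ((up t)\<^sup>2 - 1) = - 4 * lam t * (a0 t * up t - 1 + (a2 t)\<^sup>2 * (up t + 1))"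
    "2 * lam t * a2' = - 3 * a2 t * (a0 t + 1)"
proof -
  let ?F = "curvature (conn_form a0 a2) t"
  note F = curvature_conn_form[OF d0 d2]
  let ?xs = "[d_t, e_u, e_v1, e_w1, e_v2, e_w2]"
  have "wedge (\<lambda>M r. r *\<^sub>R M) 2 ?F
             (wedge (*) 2 (cy_omega up lam t) (cy_omega up lam t)) ?xs = 0"
    using inst t unfolding instanton_def by (simp add: e_tangent)
  then have "coE1 (wedge (\<lambda>M r. r *\<^sub>R M) 2 ?F
             (wedge (*) 2 (cy_omega up lam t) (cy_omega up lam t)) ?xs) = 0"
    by simp
  then show "a0' * ((up t)\<^sup>2 - 1) = - 4 * lam t * (a0 t * up t - 1 + (a2 t)\<^sup>2 * (up t + 1))"
    by (simp add: wedge_2_6 wedge_2_4 cy_omega_values F) (simp add: algebra_simps power2_eq_square)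
  let ?ys = "[d_t, e_u, e_v1, e_v2, e_w2]"
  have W: "Re (cy_Omega lam mu t [d_t, e_v1, e_v2]) = 2/3 * mu t"
    "Re (cy_Omega lam mu t [e_u, e_v1, e_w2]) = - (8/9) * lam t * mu t"
    "Re (cy_Omega lam mu t [e_v1, e_v2, e_w2]) = 0"
    "Re (cy_Omega lam mu t [e_u, e_v2, e_w2]) = 0"
    "Re (cy_Omega lam mu t [e_u, e_v1, e_v2]) = 0"
    "Re (cy_Omega lam mu t [d_t, e_v2, e_w2]) = 0"
    "Re (cy_Omega lam mu t [d_t, e_v1, e_w2]) = 0"
    "Re (cy_Omega lam mu t [d_t, e_u, e_w2]) = 0"
    "Re (cy_Omega lam mu t [d_t, e_u, e_v2]) = 0"
    "Re (cy_Omega lam mu t [d_t, e_u, e_v1]) = 0"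
    by (simp_all add: cy_Omega_def wedge_1_3 cy_values e_defs)
  have "wedge (\<lambda>M r. r *\<^sub>R M) 2 ?F (\<lambda>ys. Re (cy_Omega lam mu t ys)) ?ys = 0"
    using inst t unfolding instanton_def by (simp add: e_tangent)
  then have "coE2 (wedge (\<lambda>M r. r *\<^sub>R M) 2 ?F (\<lambda>ys. Re (cy_Omega lam mu t ys)) ?ys) = 0"
    by simp
  then have "8/9 * lam t * mu t * a2' + 4/3 * mu t * a2 t * (a0 t + 1) = 0"
    by (simp add: wedge_2_5 F W) (simp add: field_simps)
  then have "mu t * (2 * lam t * a2' + 3 * a2 t * (a0 t + 1)) = 0"
    by (simp add: field_simps)
  then show "2 * lam t * a2' = - 3 * a2 t * (a0 t + 1)" using pos by simp
qed

section \<open>Comparison on the half line\<close>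

text \<open>The comparison principle used throughout. It starts from a limit because initial values are known
only as limits at \<open>0\<close>, where the differential equations are singular.\<close>
lemma nonneg_deriv_ge_limit:
  fixes f :: "real \<Rightarrow> real"
  assumes d: "\<And>t. 0 < t \<Longrightarrow> t \<le> T \<Longrightarrow> \<exists>D\<ge>0. (f has_real_derivative D) (at t)"
    and lim: "(f \<longlongrightarrow> L) (at_right 0)" and T: "T > 0"
  shows "L \<le> f T"
proof (rule tendsto_upperbound[OF lim])
  have "eventually (\<lambda>t. t \<in> {0<..<T}) (at_right 0)"
    using T by (rule eventually_at_right_real)
  then show "eventually (\<lambda>t. f t \<le> f T) (at_right 0)"
  proof (rule eventually_mono)
    fix t assume t: "t \<in> {0<..<T}"
    show "f t \<le> f T"
    proof (rule DERIV_nonneg_imp_nondecreasing[where f = f])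
      fix x assume "t \<le> x" "x \<le> T"
      then show "\<exists>y. (f has_real_derivative y) (at x) \<and> 0 \<le> y"
        using d[of x] t by auto
    qed (use t in simp)
  qed
qed simp

text \<open>Continuous induction from the left: a function that is positive near \<open>0\<close> and cannot reach a
first zero stays positive.\<close>
lemma positive_if_no_first_zero:
  fixes f :: "real \<Rightarrow> real"
  assumes ev: "eventually (\<lambda>t. f t > 0) (at_right 0)"
    and cont: "\<And>t. t > 0 \<Longrightarrow> isCont f t"
    and step: "\<And>T. T > 0 \<Longrightarrow> (\<And>t. 0 < t \<Longrightarrow> t < T \<Longrightarrow> f t > 0) \<Longrightarrow> f T > 0"
    and t: "t > 0"
  shows "f t > 0"
proof (rule ccontr)
  assume neg: "\<not> f t > 0"
  define A where "A = {t. t > 0 \<and> f t \<le> 0}"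
  have ne: "t \<in> A" using neg t by (simp add: A_def)
  obtain r where r: "r > 0" "\<And>x. 0 < x \<Longrightarrow> x < r \<Longrightarrow> f x > 0"
    using ev unfolding eventually_at_right_field by auto
  have low: "r \<le> x" if "x \<in> A" for x
    using r(2)[of x] that unfolding A_def by force
  then have bdd: "bdd_below A" by (intro bdd_belowI)
  define a where "a = Inf A"
  have "r \<le> a" unfolding a_def by (rule cInf_greatest) (use ne low in auto)
  then have a: "a > 0" using r by simp
  have before: "f x > 0" if "0 < x" "x < a" for x
  proof (rule ccontr)
    assume "\<not> f x > 0"
    then have "x \<in> A" using that by (simp add: A_def)
    then have "a \<le> x" unfolding a_def by (rule cInf_lower[OF _ bdd])
    then show False using that by simp
  qed
  have fa: "f a > 0" using step[OF a] before by blast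
  have "eventually (\<lambda>x. f x > 0) (nhds a)"
    using cont[OF a] fa unfolding isCont_def tendsto_at_iff_tendsto_nhds
    by (rule order_tendstoD)
  then obtain d where d: "d > 0" "\<And>x. dist x a < d \<Longrightarrow> f x > 0"
    unfolding eventually_nhds_metric by blast
  have "Inf A < a + d" using d by (simp add: a_def)
  then obtain x where x: "x \<in> A" "x < a + d" using cInf_lessD[of A] ne by blast
  have "a \<le> x" unfolding a_def by (rule cInf_lower[OF x(1) bdd])
  then have "f x > 0" using d(2)[of x] x(2) by (simp add: dist_real_def)
  then show False using x(1) by (simp add: A_def)
qed

text \<open>A barrier argument. For every \<open>e > 0\<close> the function \<open>f + e\<close> has no first zero, because just before it
\<open>f\<close> would be negative, hence nondecreasing, and so already at most \<open>- e\<close>.\<close>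
lemma nonneg_if_increasing_where_negative:
  fixes f :: "real \<Rightarrow> real"
  assumes d: "\<And>t. t > 0 \<Longrightarrow> (f has_real_derivative f' t) (at t)"
    and inc: "\<And>t. t > 0 \<Longrightarrow> f t < 0 \<Longrightarrow> f' t \<ge> 0"
    and lim: "(f \<longlongrightarrow> 0) (at_right 0)" and t: "t > 0"
  shows "f t \<ge> 0"
proof (rule field_le_epsilon)
  fix e :: real assume e: "e > 0"
  have "f t + e > 0"
  proof (rule positive_if_no_first_zero[where f = "\<lambda>t. f t + e"])
    show "eventually (\<lambda>t. f t + e > 0) (at_right 0)"
      using order_tendstoD(1)[OF lim, of "- e"] e by (auto elim: eventually_mono)
    show "isCont (\<lambda>t. f t + e) t" if "t > 0" for t
      by (intro continuous_intros DERIV_isCont[OF d[OF that]])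
    fix T :: real assume T: "T > 0" and pos: "\<And>t. 0 < t \<Longrightarrow> t < T \<Longrightarrow> f t + e > 0"
    show "f T + e > 0"
    proof (rule ccontr)
      assume n: "\<not> f T + e > 0"
      have "eventually (\<lambda>x. f x < 0) (nhds T)"
        using DERIV_isCont[OF d[OF T]] n e unfolding isCont_def tendsto_at_iff_tendsto_nhds
        by (intro order_tendstoD) auto
      then obtain r where r: "r > 0" "\<And>x. dist x T < r \<Longrightarrow> f x < 0"
        unfolding eventually_nhds_metric by blast
      define a where "a = max (T / 2) (T - r / 2)"
      have a: "0 < a" "a < T" "T - r < a" using T r by (auto simp: a_def)
      have "f a \<le> f T"
      proof (rule DERIV_nonneg_imp_nondecreasing[where f = f])
        fix x assume x: "a \<le> x" "x \<le> T"
        have "f x < 0" by (rule r(2)) (use x a in \<open>auto simp: dist_real_def\<close>)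
        then show "\<exists>y. DERIV f x :> y \<and> y \<ge> 0" using d[of x] inc[of x] x a by auto
      qed (use a in simp)
      then show False using pos[OF a(1,2)] n by simp
    qed
  qed (fact t)
  then show "0 \<le> f t + e" by simp
qed

section \<open>The Candelas-de la Ossa metric near the zero section\<close>

lemma candelas_gt_1:
  assumes "candelas_de_la_ossa up lam mu" "t > 0"
  shows "up t > 1"
proof -
  have "up 0 < up t"
  proof (rule DERIV_pos_imp_increasing_open[where f = up])
    show "continuous_on {0..t} up"
      using assms by (auto simp: candelas_de_la_ossa_def intro: continuous_on_subset)
    fix x assume x: "0 < x" "x < t"
    then show "\<exists>y. (up has_real_derivative y) (at x) \<and> 0 < y"
      using assms by (intro exI[of _ "2 * lam x"]) (auto simp: candelas_de_la_ossa_def)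
  qed fact
  then show ?thesis using assms by (simp add: candelas_de_la_ossa_def)
qed

lemma candelas_lim:
  assumes "candelas_de_la_ossa up lam mu"
  shows "((\<lambda>t. up t - 1) \<longlongrightarrow> 0) (at_right 0)"
proof -
  have "continuous_on {0..} up" using assms by (simp add: candelas_de_la_ossa_def)
  then have "(up \<longlongrightarrow> up 0) (at 0 within {0..})" by (simp add: continuous_on_def)
  then have "(up \<longlongrightarrow> 1) (at_right 0)"
    using assms by (simp add: candelas_de_la_ossa_def at_within_Ici_at_right)
  then show ?thesis using tendsto_diff[OF _ tendsto_const[of 1]] by fastforce
qed

lemma candelas_lam:
  assumes C: "candelas_de_la_ossa up lam mu" and t: "t > 0"
  shows "(lam t)\<^sup>2 = (up t - 1) * (up t + 2) / (up t + 1)"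
proof -
  have u: "up t > 1" by (rule candelas_gt_1[OF C t])
  have "up t ^ 3 - 3 * up t + 2 = (up t - 1) * ((up t - 1) * (up t + 2))"
    "up t ^ 2 - 1 = (up t - 1) * (up t + 1)"
    by (simp_all add: algebra_simps power3_eq_cube power2_eq_square)
  then show ?thesis using C t u by (simp add: candelas_de_la_ossa_def)
qed

text \<open>The square root of \<open>s = u\<^sub>1 - 1\<close> has derivative \<open>sqrt ((s + 3) / (s + 2))\<close>, which is at most
\<open>sqrt (3/2)\<close> and decreases in \<open>s\<close>; integrating from \<open>0\<close> gives both bounds.\<close>
lemma candelas_depth_bounds:
  assumes C: "candelas_de_la_ossa up lam mu" and t: "t > 0"
  shows "up t - 1 \<le> 3/2 * t\<^sup>2" "t\<^sup>2 * ((up t - 1 + 3) / (up t - 1 + 2)) \<le> up t - 1"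
proof -
  define r where "r t = sqrt (up t - 1)" for t
  define g where "g t = sqrt ((up t + 2) / (up t + 1))" for t
  note u = candelas_gt_1[OF C]
  have r_deriv: "(r has_real_derivative g t) (at t)" if t: "t > 0" for t
  proof -
    have "lam t > 0" using C t by (simp add: candelas_de_la_ossa_def)
    then have "lam t = sqrt ((lam t)\<^sup>2)" by simp
    also have "\<dots> = r t * g t"
      unfolding candelas_lam[OF C t] r_def g_def by (simp flip: real_sqrt_mult)
    finally have l: "lam t = r t * g t" .
    have "(up has_real_derivative 2 * lam t) (at t)" using C t by (simp add: candelas_de_la_ossa_def)
    then have "((\<lambda>t. sqrt (up t - 1)) has_real_derivative inverse (r t) / 2 * (2 * lam t)) (at t)"
      unfolding r_def
      by - (rule derivative_eq_intros refl | use u[OF t] in simp)+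
    then have "(r has_real_derivative inverse (r t) / 2 * (2 * lam t)) (at t)"
      by (simp only: r_def[abs_def])
    moreover have "r t > 0" using u[OF t] by (simp add: r_def)
    then have "inverse (r t) / 2 * (2 * lam t) = g t" by (simp add: l field_simps)
    ultimately show ?thesis by (simp only:)
  qed
  have "(r \<longlongrightarrow> sqrt 0) (at_right 0)"
    unfolding r_def by (intro tendsto_intros candelas_lim[OF C])
  then have r_lim: "(r \<longlongrightarrow> 0) (at_right 0)" by simp
  have r_sq: "(r t)\<^sup>2 = up t - 1" "r t \<ge> 0" using u[OF t] by (simp_all add: r_def)
  have "0 \<le> sqrt (3/2) * t - r t"
  proof (rule nonneg_deriv_ge_limit[where f = "\<lambda>t. sqrt (3/2) * t - r t", OF _ _ t])
    have "((\<lambda>t. sqrt (3/2) * t - r t) \<longlongrightarrow> sqrt (3/2) * 0 - 0) (at_right 0)"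
      by (intro tendsto_intros r_lim)
    then show "((\<lambda>t. sqrt (3/2) * t - r t) \<longlongrightarrow> 0) (at_right 0)" by simp
    fix x assume x: "0 < x" "x \<le> t"
    have "((\<lambda>t. sqrt (3/2) * t - r t) has_real_derivative sqrt (3/2) - g x) (at x)"
      by (rule derivative_eq_intros r_deriv x refl)+ simp
    moreover have "g x \<le> sqrt (3/2)" unfolding g_def using u[OF x(1)] by (simp add: divide_simps)
    ultimately show "\<exists>D\<ge>0. ((\<lambda>t. sqrt (3/2) * t - r t) has_real_derivative D) (at x)"
      by (intro exI[of _ "sqrt (3/2) - g x"]) simp
  qed
  then have "(r t)\<^sup>2 \<le> (sqrt (3/2) * t)\<^sup>2" using r_sq by (intro power_mono) auto
  then show "up t - 1 \<le> 3/2 * t\<^sup>2" by (simp add: r_sq power_mult_distrib)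
  have "0 \<le> r t - g t * t"
  proof (rule nonneg_deriv_ge_limit[where f = "\<lambda>x. r x - g t * x", OF _ _ t])
    have "((\<lambda>x. r x - g t * x) \<longlongrightarrow> 0 - g t * 0) (at_right 0)"
      by (intro tendsto_intros r_lim)
    then show "((\<lambda>x. r x - g t * x) \<longlongrightarrow> 0) (at_right 0)" by simp
    fix x assume x: "0 < x" "x \<le> t"
    have "((\<lambda>x. r x - g t * x) has_real_derivative g x - g t) (at x)"
      by (rule derivative_eq_intros r_deriv x refl)+ simp
    moreover have "g t \<le> g x"
    proof -
      have "up x \<le> up t"
      proof (rule DERIV_nonneg_imp_nondecreasing[where f = up, OF x(2)])
        fix y assume "x \<le> y" "y \<le> t"
        then show "\<exists>z. (up has_real_derivative z) (at y) \<and> 0 \<le> z"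
          using C x by (intro exI[of _ "2 * lam y"]) (auto simp: candelas_de_la_ossa_def less_imp_le)
      qed
      then have "(up t + 2) / (up t + 1) \<le> (up x + 2) / (up x + 1)"
        using u[OF x(1)] u[OF t] by (simp add: divide_simps) (simp add: algebra_simps)
      then show ?thesis by (simp add: g_def)
    qed
    ultimately show "\<exists>D\<ge>0. ((\<lambda>x. r x - g t * x) has_real_derivative D) (at x)"
      by (intro exI[of _ "g x - g t"]) simp
  qed
  moreover have "g t \<ge> 0" using u[OF t] by (simp add: g_def)
  ultimately have "(g t * t)\<^sup>2 \<le> (r t)\<^sup>2" using t by (intro power_mono) auto
  moreover have "(g t)\<^sup>2 = (up t + 2) / (up t + 1)" using u[OF t] by (simp add: g_def)
  moreover have "up t - 1 + 3 = up t + 2" "up t - 1 + 2 = up t + 1" by simp_all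
  ultimately show "t\<^sup>2 * ((up t - 1 + 3) / (up t - 1 + 2)) \<le> up t - 1"
    by (simp only: r_sq power_mult_distrib mult.commute)
qed

lemma candelas_depth_lim:
  assumes C: "candelas_de_la_ossa up lam mu"
  shows "((\<lambda>t. (up t - 1) / t\<^sup>2) \<longlongrightarrow> 3/2) (at_right 0)"
proof (rule tendsto_sandwich)
  have pos: "eventually (\<lambda>t::real. t > 0) (at_right 0)" by (simp add: eventually_at_right_less)
  show "eventually (\<lambda>t. (up t - 1 + 3) / (up t - 1 + 2) \<le> (up t - 1) / t\<^sup>2) (at_right 0)"
    using pos
  proof eventually_elim
    case (elim t)
    then show ?case using candelas_depth_bounds(2)[OF C elim]
      by (subst pos_le_divide_eq) (simp_all only: mult.commute zero_less_power)
  qed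
  show "eventually (\<lambda>t. (up t - 1) / t\<^sup>2 \<le> 3/2) (at_right 0)"
    using pos by eventually_elim (use candelas_depth_bounds(1)[OF C] in \<open>simp add: divide_simps\<close>)
  have "((\<lambda>t. (up t - 1 + 3) / (up t - 1 + 2)) \<longlongrightarrow> (0 + 3) / (0 + 2)) (at_right 0)"
    by (intro tendsto_intros candelas_lim[OF C]) simp
  then show "((\<lambda>t. (up t - 1 + 3) / (up t - 1 + 2)) \<longlongrightarrow> 3/2) (at_right 0)" by simp
qed simp

section \<open>Estimates uniform in the parameter\<close>

text \<open>The system solved by \<open>s = u\<^sub>1 - 1\<close>, \<open>p = a0 + 1\<close> and \<open>c = a2\<close>, with \<open>l\<close> the coefficient \<open>\<lambda>\<close>. All
derivatives carry the factor \<open>2 l = ds/dt\<close>, so that \<open>l\<close> disappears when \<open>s\<close> is the independent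
variable; the comments below write \<open>d/ds\<close> for the \<open>t\<close>-derivative divided by \<open>2 l\<close>. The two limits at \<open>0\<close>
encode the parameter of the family, since \<open>s\<close> is asymptotic to \<open>3/2 t\<^sup>2\<close>.\<close>
locale radial_instanton =
  fixes s l p c :: "real \<Rightarrow> real" and \<epsilon> :: real
  assumes s_ode: "t > 0 \<Longrightarrow> (s has_real_derivative 2 * l t) (at t)"
    and s_pos: "t > 0 \<Longrightarrow> s t > 0" and l_pos: "t > 0 \<Longrightarrow> l t > 0"
    and s_lim: "(s \<longlongrightarrow> 0) (at_right 0)"
    and p_ode: "t > 0 \<Longrightarrow> (p has_real_derivative
          2 * l t * (2 * (1 - (c t)\<^sup>2) / s t - 2 * (1 + s t) / (s t * (s t + 2)) * p t)) (at t)"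
    and c_ode: "t > 0 \<Longrightarrow> (c has_real_derivative
          2 * l t * (- (3 * (s t + 2) / (4 * s t * (s t + 3)) * (c t * p t)))) (at t)"
    and p_lim: "((\<lambda>t. p t / s t) \<longlongrightarrow> 2 * \<epsilon> / 3) (at_right 0)"
    and c_lim: "((\<lambda>t. (1 - c t) / s t) \<longlongrightarrow> \<epsilon> / 3) (at_right 0)"
    and eps: "\<epsilon> > 0"
begin

definition p_rate where
  "p_rate t = 2 * (1 - (c t)\<^sup>2) / s t - 2 * (1 + s t) / (s t * (s t + 2)) * p t"

definition c_rate where
  "c_rate t = 3 * (s t + 2) / (4 * s t * (s t + 3)) * p t"

lemma p_deriv: "t > 0 \<Longrightarrow> (p has_real_derivative 2 * l t * p_rate t) (at t)"
  unfolding p_rate_def by (rule p_ode)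

lemma c_deriv: "t > 0 \<Longrightarrow> (c has_real_derivative 2 * l t * (- (c_rate t * c t))) (at t)"
  by (rule DERIV_cong[OF c_ode]) (simp_all add: c_rate_def)

lemma ge_limit:
  assumes d: "\<And>t. 0 < t \<Longrightarrow> (f has_real_derivative 2 * l t * D t) (at t)"
    and D: "\<And>t. 0 < t \<Longrightarrow> t \<le> T \<Longrightarrow> 0 \<le> D t"
    and lim: "(f \<longlongrightarrow> L) (at_right 0)" and T: "0 < T"
  shows "L \<le> f T"
proof (rule nonneg_deriv_ge_limit[OF _ lim T])
  fix t :: real assume t: "0 < t" "t \<le> T"
  then show "\<exists>D\<ge>0. (f has_real_derivative D) (at t)"
    using d[OF t(1)] D[OF t] l_pos[OF t(1)] by (intro exI[of _ "2 * l t * D t"]) auto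
qed

lemma ev_pos: "eventually (\<lambda>t::real. t > 0) (at_right 0)"
  by (simp add: eventually_at_right_less)

lemma p_lim0: "(p \<longlongrightarrow> 0) (at_right 0)"
proof (rule Lim_transform_eventually)
  show "((\<lambda>t. p t / s t * s t) \<longlongrightarrow> 0) (at_right 0)"
    using tendsto_mult[OF p_lim s_lim] by simp
  show "eventually (\<lambda>t. p t / s t * s t = p t) (at_right 0)"
    using ev_pos by eventually_elim (use s_pos in \<open>simp add: less_imp_neq[symmetric]\<close>)
qed

lemma c_lim1: "(c \<longlongrightarrow> 1) (at_right 0)"
proof (rule Lim_transform_eventually)
  show "((\<lambda>t. 1 - (1 - c t) / s t * s t) \<longlongrightarrow> 1) (at_right 0)"
    using tendsto_diff[OF tendsto_const[of 1] tendsto_mult[OF c_lim s_lim]] by simp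
  show "eventually (\<lambda>t. 1 - (1 - c t) / s t * s t = c t) (at_right 0)"
    using ev_pos by eventually_elim (use s_pos in \<open>simp add: less_imp_neq[symmetric]\<close>)
qed

lemmas isConts = DERIV_isCont[OF s_ode] DERIV_isCont[OF p_ode] DERIV_isCont[OF c_ode]

text \<open>The equation for \<open>c\<close> is linear and homogeneous. On \<open>[T/2, T]\<close> its coefficient is bounded by some
\<open>K\<close>, so \<open>c exp (K s)\<close> does not decrease up to a first zero \<open>T\<close> of \<open>c\<close>, which is absurd.\<close>
lemma c_pos: "t > 0 \<Longrightarrow> c t > 0"
proof (rule positive_if_no_first_zero[where f = c])
  show "eventually (\<lambda>t. c t > 0) (at_right 0)" using order_tendstoD(1)[OF c_lim1, of 0] by simp
  show "isCont c t" if "t > 0" for t by (rule isConts that)+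
  fix T :: real assume T: "T > 0" and pos: "\<And>t. 0 < t \<Longrightarrow> t < T \<Longrightarrow> c t > 0"
  have "continuous_on {T/2..T} c_rate" unfolding c_rate_def
  proof (intro continuous_at_imp_continuous_on ballI)
    fix t assume "t \<in> {T/2..T}"
    then have t: "t > 0" using T by auto
    show "isCont (\<lambda>t. 3 * (s t + 2) / (4 * s t * (s t + 3)) * p t) t"
      using s_pos[OF t] by (intro continuous_intros isConts t) auto
  qed
  then have "bounded (c_rate ` {T/2..T})" by (intro compact_imp_bounded compact_continuous_image) auto
  then obtain K where K: "\<And>t. t \<in> {T/2..T} \<Longrightarrow> \<bar>c_rate t\<bar> \<le> K"
    unfolding bounded_iff by (auto simp del: atLeastAtMost_iff)
  have "c (T/2) * exp (K * s (T/2)) \<le> c T * exp (K * s T)"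
  proof (rule DERIV_nonneg_imp_increasing_open[where f = "\<lambda>t. c t * exp (K * s t)"])
    show "T / 2 \<le> T" using T by simp
    show "continuous_on {T/2..T} (\<lambda>t. c t * exp (K * s t))"
      by (intro continuous_at_imp_continuous_on ballI continuous_intros isConts) (use T in auto)
    fix t assume t: "T / 2 < t" "t < T"
    then have t0: "t > 0" using T by simp
    have "((\<lambda>t. c t * exp (K * s t)) has_real_derivative
       2 * l t * ((K - c_rate t) * c t * exp (K * s t))) (at t)"
      by (rule derivative_eq_intros c_deriv s_ode t0 refl)+ (simp add: algebra_simps)
    moreover have "2 * l t * ((K - c_rate t) * c t * exp (K * s t)) \<ge> 0"
      using l_pos[OF t0] pos[OF t0 t(2)] K[of t] t by (intro mult_nonneg_nonneg) auto
    ultimately show "\<exists>y. ((\<lambda>t. c t * exp (K * s t)) has_real_derivative y) (at t) \<and> 0 \<le> y" by blast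
  qed
  moreover have "c (T/2) > 0" using pos[of "T/2"] T by simp
  ultimately have "0 < c T * exp (K * s T)"
    by (meson exp_gt_zero less_le_trans mult_pos_pos)
  then show "c T > 0" by (simp add: zero_less_mult_iff)
qed

lemma c_le_1_while_p_pos:
  assumes p: "\<And>t. 0 < t \<Longrightarrow> t < T \<Longrightarrow> p t > 0" and t: "0 < t" "t < T"
  shows "c t \<le> 1"
proof -
  have "- 1 \<le> - c t"
  proof (rule ge_limit[where f = "\<lambda>t. - c t"])
    fix x :: real assume x: "0 < x"
    show "((\<lambda>x. - c x) has_real_derivative
      2 * l x * (c_rate x * c x)) (at x)"
      by (rule derivative_eq_intros c_deriv x refl)+ simp
    assume "x \<le> t"
    then show "0 \<le> c_rate x * c x"
      unfolding c_rate_def using s_pos[OF x] c_pos[OF x] p[OF x] t by auto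
  qed (use t c_lim1 in \<open>auto intro: tendsto_minus\<close>)
  then show ?thesis by simp
qed

text \<open>The function \<open>s (s + 2)\<close> is an integrating factor of the linear part of the equation for \<open>p\<close>.\<close>
lemma flux_deriv:
  assumes t: "t > 0"
  shows "((\<lambda>t. s t * (s t + 2) * p t) has_real_derivative
     2 * l t * (2 * (s t + 2) * (1 - (c t)\<^sup>2))) (at t)"
proof -
  have S: "s t > 0" "s t + 2 \<noteq> 0" "s t \<noteq> 0" using s_pos[OF t] by auto
  have "s t * (s t + 2) * p_rate t = 2 * (s t + 2) * (1 - (c t)\<^sup>2) - 2 * (1 + s t) * p t"
    using S by (simp add: p_rate_def divide_simps) (simp add: algebra_simps)
  then have "2 * (s t + 2) * (1 - (c t)\<^sup>2) = 2 * (1 + s t) * p t + s t * (s t + 2) * p_rate t"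
    by simp
  moreover have "((\<lambda>t. s t * (s t + 2) * p t) has_real_derivative
     2 * l t * (2 * (1 + s t) * p t + s t * (s t + 2) * p_rate t)) (at t)"
    by (rule derivative_eq_intros s_ode p_deriv t refl)+ (simp add: algebra_simps)
  ultimately show ?thesis by simp
qed

text \<open>As long as \<open>p > 0\<close>, \<open>c\<close> decreases from \<open>1\<close>, hence \<open>s (s + 2) p\<close> increases and \<open>p\<close> cannot reach \<open>0\<close>.\<close>
lemma p_pos: "t > 0 \<Longrightarrow> p t > 0"
proof (rule positive_if_no_first_zero[where f = p])
  have "eventually (\<lambda>t. p t / s t > 0) (at_right 0)"
    using order_tendstoD(1)[OF p_lim, of 0] eps by simp
  with ev_pos show "eventually (\<lambda>t. p t > 0) (at_right 0)"
    by eventually_elim (use s_pos in \<open>force simp: zero_less_divide_iff\<close>)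
  show "isCont p t" if "t > 0" for t by (rule isConts that)+
  fix T :: real assume T: "T > 0" and pos: "\<And>t. 0 < t \<Longrightarrow> t < T \<Longrightarrow> p t > 0"
  let ?q = "\<lambda>t. s t * (s t + 2) * p t"
  have "?q (T/2) \<le> ?q T"
  proof (rule DERIV_nonneg_imp_increasing_open[where f = ?q])
    show "T / 2 \<le> T" using T by simp
    show "continuous_on {T/2..T} ?q"
      by (intro continuous_at_imp_continuous_on ballI continuous_intros isConts) (use T in auto)
    fix t assume t: "T / 2 < t" "t < T"
    then have t0: "t > 0" using T by simp
    have "c t \<le> 1" "c t > 0" using c_le_1_while_p_pos[OF pos t0 t(2)] c_pos[OF t0] by auto
    then have "(c t)\<^sup>2 \<le> 1" by (simp add: power_le_one)
    then have "2 * l t * (2 * (s t + 2) * (1 - (c t)\<^sup>2)) \<ge> 0"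
      using l_pos[OF t0] s_pos[OF t0] by (intro mult_nonneg_nonneg) auto
    then show "\<exists>y. (?q has_real_derivative y) (at t) \<and> 0 \<le> y" using flux_deriv[OF t0] by blast
  qed
  moreover have "?q (T/2) > 0" using pos[of "T/2"] s_pos[of "T/2"] T by simp
  ultimately have "?q T > 0" by linarith
  then show "p T > 0" using s_pos[OF T] by (auto simp: zero_less_mult_iff mult_less_0_iff)
qed

lemma c_le_1: "t > 0 \<Longrightarrow> c t \<le> 1"
  using c_le_1_while_p_pos[of "t + 1" t] p_pos by simp

text \<open>On the leading-order solution \<open>p = 2 (1 - c)\<close>. Put \<open>E = 2 (1 - c) - p\<close>. The equations give
\<open>s dE/ds = - (1 + c) E + s / (s + 2) p + s / (2 (s + 3)) c p\<close>. The last two terms, which measure the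
deviation of the geometry from flat space, are nonnegative, so \<open>E\<close> increases wherever it is negative.\<close>
lemma p_le:
  assumes t: "t > 0"
  shows "p t \<le> 2 * (1 - c t)"
proof -
  define D where "D t = 2 * (c_rate t * c t) - p_rate t" for t
  have "0 \<le> 2 * (1 - c t) - p t"
  proof (rule nonneg_if_increasing_where_negative[where f = "\<lambda>t. 2 * (1 - c t) - p t" and f' = "\<lambda>t. 2 * l t * D t"])
    show "((\<lambda>t. 2 * (1 - c t) - p t) has_real_derivative 2 * l t * D t) (at t)" if "t > 0" for t
      by (rule derivative_eq_intros c_deriv p_deriv that refl)+ (simp add: D_def algebra_simps)
    have "((\<lambda>t. 2 * (1 - c t) - p t) \<longlongrightarrow> 2 * (1 - 1) - 0) (at_right 0)"
      by (intro tendsto_intros c_lim1 p_lim0)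
    then show "((\<lambda>t. 2 * (1 - c t) - p t) \<longlongrightarrow> 0) (at_right 0)" by simp
    fix t :: real assume t: "t > 0" and neg: "2 * (1 - c t) - p t < 0"
    define S C P where "S = s t" and "C = c t" and "P = p t"
    have pos: "S > 0" "C > 0" "P > 0" using s_pos c_pos p_pos t by (auto simp: S_def C_def P_def)
    have "2 * (1 - C\<^sup>2) = 2 * (1 - C) * (1 + C)" by (simp add: algebra_simps power2_eq_square)
    also have "\<dots> \<le> P * (1 + C)" using neg pos by (intro mult_right_mono) (auto simp: C_def P_def)
    finally have 1: "2 * (1 - C\<^sup>2) / S \<le> P * (1 + C) / S" using pos by (simp add: divide_right_mono)
    have "2 * (1 + S) / (S * (S + 2)) * P = P / S + P / (S + 2)"
      "2 * (3 * (S + 2) / (4 * S * (S + 3)) * P * C) = C * P / S + C * P / (2 * (S + 3))"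
      using pos by (simp_all add: divide_simps) (simp_all add: algebra_simps)
    moreover have "P / (S + 2) \<ge> 0" "C * P / (2 * (S + 3)) \<ge> 0" using pos by simp_all
    ultimately have 2: "2 * (1 + S) / (S * (S + 2)) * P \<ge> P / S"
      "2 * (3 * (S + 2) / (4 * S * (S + 3)) * P * C) \<ge> C * P / S"
      by linarith+
    have 3: "P * (1 + C) / S = P / S + C * P / S" using pos by (simp add: field_simps)
    have "0 \<le> D t" unfolding D_def p_rate_def c_rate_def S_def[symmetric] C_def[symmetric] P_def[symmetric]
      using 1 2 3 by linarith
    then show "0 \<le> 2 * l t * D t" using l_pos[OF t] by simp
  qed (fact t)
  then show ?thesis by simp
qed

text \<open>This bounds \<open>E = 2 (1 - c) - p\<close> from above by \<open>2/3 s (1 - c)\<close>, with a constant that does not depend on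
\<open>\<epsilon>\<close>. The factor \<open>1 - c\<close> makes the error small relative to \<open>1 - c\<close> itself and is what allows
integrating the equation for \<open>z\<close> down to \<open>s = 0\<close>. It is obtained by showing that
\<open>2/3 s\<^sup>2 (1 - c) - s E\<close> increases from \<open>0\<close>.\<close>
lemma p_ge:
  assumes t: "t > 0"
  shows "p t \<ge> 2 * (1 - c t) - 2/3 * s t * (1 - c t)"
proof -
  define D where "D t = 4/3 * s t * (1 - c t) + 2/3 * (s t)\<^sup>2 * (c_rate t * c t) - (2 * (1 - c t) - p t)
      - s t * (2 * (c_rate t * c t) - p_rate t)" for t
  have "0 \<le> 2/3 * (s t)\<^sup>2 * (1 - c t) - s t * (2 * (1 - c t) - p t)"
  proof (rule ge_limit[where f = "\<lambda>t. 2/3 * (s t)\<^sup>2 * (1 - c t) - s t * (2 * (1 - c t) - p t)"])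
    show "((\<lambda>t. 2/3 * (s t)\<^sup>2 * (1 - c t) - s t * (2 * (1 - c t) - p t)) has_real_derivative
        2 * l t * D t) (at t)" if "t > 0" for t
      by (rule derivative_eq_intros s_ode c_deriv p_deriv that refl)+
        (simp add: D_def algebra_simps power2_eq_square)
    have "((\<lambda>t. 2/3 * (s t)\<^sup>2 * (1 - c t) - s t * (2 * (1 - c t) - p t)) \<longlongrightarrow>
       2/3 * 0\<^sup>2 * (1 - 1) - 0 * (2 * (1 - 1) - 0)) (at_right 0)"
      by (intro tendsto_intros c_lim1 p_lim0 s_lim)
    then show "((\<lambda>t. 2/3 * (s t)\<^sup>2 * (1 - c t) - s t * (2 * (1 - c t) - p t)) \<longlongrightarrow> 0) (at_right 0)"
      by simp
    fix t :: real assume t: "t > 0"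
    define S C P where "S = s t" and "C = c t" and "P = p t"
    have pos: "S > 0" "C > 0" "P > 0" "C \<le> 1" "P \<le> 2 * (1 - C)"
      using s_pos c_pos p_pos t c_le_1 p_le by (auto simp: S_def C_def P_def)
    have k: "2 * (S * (c_rate t * C)) = (1 + S / (2 * (S + 3))) * (C * P)"
      unfolding c_rate_def S_def[symmetric] C_def[symmetric] P_def[symmetric]
      using pos by (simp add: divide_simps)
    have "S * p_rate t = 2 * (1 - C\<^sup>2) - (1 + S / (S + 2)) * P"
      unfolding p_rate_def S_def[symmetric] C_def[symmetric] P_def[symmetric]
      using pos by (simp add: divide_simps)
    with k have "2 * (S * (c_rate t * C)) - S * p_rate t =
        (1 + S / (2 * (S + 3))) * (C * P) - (2 * (1 - C\<^sup>2) - (1 + S / (S + 2)) * P)"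
      by simp
    then have "D t = 4/3 * S * (1 - C) + 2/3 * S\<^sup>2 * (c_rate t * C) + C * (2 * (1 - C) - P)
        - S / (2 * (S + 3)) * (C * P) - S / (S + 2) * P"
      unfolding D_def S_def[symmetric] C_def[symmetric] P_def[symmetric]
      by (simp add: algebra_simps power2_eq_square)
    moreover have "S / (2 * (S + 3)) * (C * P) \<le> S / 6 * P"
    proof (rule mult_mono)
      show "S / (2 * (S + 3)) \<le> S / 6" using pos by (intro divide_left_mono) auto
      show "C * P \<le> P" using pos by (simp add: mult_left_le_one_le)
    qed (use pos in auto)
    moreover have "S / (S + 2) * P \<le> S / 2 * P"
      using pos by (intro mult_right_mono divide_left_mono) auto
    moreover have "S * P \<le> S * (2 * (1 - C))" using pos by (intro mult_left_mono) auto
    then have "S / 6 * P + S / 2 * P \<le> 4/3 * S * (1 - C)" by (simp add: algebra_simps)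
    moreover have "c_rate t * C \<ge> 0" using pos unfolding c_rate_def S_def C_def P_def by auto
    then have "2/3 * S\<^sup>2 * (c_rate t * C) \<ge> 0" by simp
    moreover have "C * (2 * (1 - C) - P) \<ge> 0" using pos by simp
    ultimately show "0 \<le> D t" by linarith
  qed (fact t)
  then have "0 \<le> s t * (2/3 * s t * (1 - c t) - (2 * (1 - c t) - p t))"
    by (simp add: algebra_simps power2_eq_square)
  then show ?thesis using s_pos[OF t] by (simp add: zero_le_mult_iff)
qed

text \<open>On the leading-order solution \<open>c = 1 / (1 + \<epsilon> s / 3)\<close> this variable is linear in \<open>s\<close>.\<close>
definition z where "z t = (1 - c t) / c t"

lemma z_nonneg: "t > 0 \<Longrightarrow> z t \<ge> 0"
  using c_pos[of t] c_le_1[of t] by (simp add: z_def)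

lemma c_eq: "t > 0 \<Longrightarrow> c t = 1 / (1 + z t)"
  using c_pos[of t] by (simp add: z_def field_simps)

lemma z_over_s_lim: "((\<lambda>t. z t / s t) \<longlongrightarrow> \<epsilon> / 3) (at_right 0)"
proof -
  have "((\<lambda>t. (1 - c t) / s t / c t) \<longlongrightarrow> \<epsilon> / 3 / 1) (at_right 0)"
    by (intro tendsto_intros c_lim c_lim1) simp
  then show ?thesis by (simp add: z_def mult.commute)
qed

lemma z_scaled_deriv:
  assumes t: "t > 0"
  shows "((\<lambda>t. z t / s t * exp (r * s t)) has_real_derivative
     2 * l t * (exp (r * s t) / (s t * c t) *
       (c_rate t - (1 - c t) * (1 / s t - r)))) (at t)"
proof -
  have n: "c t \<noteq> 0" "s t \<noteq> 0" using c_pos[OF t] s_pos[OF t] by auto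
  show ?thesis unfolding z_def
    by (rule derivative_eq_intros c_deriv s_ode t refl n)+
      (use n in \<open>simp add: divide_simps, simp add: algebra_simps power2_eq_square\<close>)
qed

text \<open>By the two bounds on \<open>p\<close>, the logarithmic derivative of \<open>z / s\<close> in \<open>s\<close> lies between \<open>-1/2\<close> and \<open>1/6\<close>,
and \<open>z / s\<close> tends to \<open>\<epsilon> / 3\<close> at the zero section. Together with the upper bound after it, this controls
\<open>c\<close> for all \<open>\<epsilon>\<close> and on the whole half line.\<close>
lemma z_ge:
  assumes t: "t > 0"
  shows "z t \<ge> \<epsilon> / 3 * s t * exp (- s t / 2)"
proof -
  have "\<epsilon> / 3 \<le> z t / s t * exp (1/2 * s t)"
  proof (rule ge_limit[where f = "\<lambda>t. z t / s t * exp (1/2 * s t)", OF z_scaled_deriv])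
    have "((\<lambda>t. z t / s t * exp (1/2 * s t)) \<longlongrightarrow> \<epsilon> / 3 * exp (1/2 * 0)) (at_right 0)"
      by (intro tendsto_intros z_over_s_lim s_lim)
    then show "((\<lambda>t. z t / s t * exp (1/2 * s t)) \<longlongrightarrow> \<epsilon> / 3) (at_right 0)" by simp
    fix t :: real assume t: "0 < t"
    define S C P where "S = s t" and "C = c t" and "P = p t"
    have pos: "S > 0" "C > 0" "P > 0" "C \<le> 1" "P \<ge> 2 * (1 - C) - 2/3 * S * (1 - C)"
      using s_pos c_pos p_pos t c_le_1 p_ge by (auto simp: S_def C_def P_def)
    have "(1 - C) * (1 / S - 1/2) \<le> 3 * (S + 2) / (4 * S * (S + 3)) * P"
      \<comment> \<open>For large \<open>S\<close> the lower bound on \<open>P\<close> is useless, but then the left-hand side is negative.\<close>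
    proof (cases "S \<le> 3")
      case True
      have "(1 - C) * (1 / S - 1/2) \<le> 1 / (2 * S) * ((1 - C) * (2 - 2/3 * S))"
        using pos True by (simp add: field_simps)
      also have "\<dots> \<le> 1 / (2 * S) * P" using pos by (intro mult_left_mono) (auto simp: algebra_simps)
      also have "\<dots> \<le> 3 * (S + 2) / (4 * S * (S + 3)) * P"
      proof (rule mult_right_mono)
        have "1 / (2 * S) = (2 * (S + 3)) / (4 * S * (S + 3))"
          using pos by (simp add: divide_simps)
        also have "\<dots> \<le> 3 * (S + 2) / (4 * S * (S + 3))"
          using pos by (intro divide_right_mono) auto
        finally show "1 / (2 * S) \<le> 3 * (S + 2) / (4 * S * (S + 3))" .
      qed (use pos in simp)
      finally show ?thesis .
    next
      case False
      have "1 / S \<le> 1 / 2" using False by (intro divide_left_mono) auto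
      then have "(1 - C) * (1 / S - 1/2) \<le> 0" using pos by (intro mult_nonneg_nonpos) auto
      also have "0 \<le> 3 * (S + 2) / (4 * S * (S + 3)) * P" using pos by auto
      finally show ?thesis .
    qed
    then show "0 \<le> exp (1/2 * s t) / (s t * c t) *
       (c_rate t - (1 - c t) * (1 / s t - 1/2))"
      using pos unfolding c_rate_def S_def C_def P_def by (intro mult_nonneg_nonneg) auto
  qed (use t in auto)
  then have "\<epsilon> / 3 * (s t * exp (- s t / 2)) \<le> z t / s t * exp (1/2 * s t) * (s t * exp (- s t / 2))"
    using s_pos[OF t] by (intro mult_right_mono) auto
  also have "\<dots> = z t * exp (1/2 * s t + - s t / 2)"
    using s_pos[OF t] unfolding exp_add by simp
  finally show ?thesis by (simp add: mult.assoc)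
qed

lemma z_le:
  assumes t: "t > 0"
  shows "z t \<le> \<epsilon> / 3 * s t * exp (s t / 6)"
proof -
  have "- (\<epsilon> / 3) \<le> - (z t / s t * exp (-1/6 * s t))"
  proof (rule ge_limit[where f = "\<lambda>t. - (z t / s t * exp (-1/6 * s t))"])
    show "((\<lambda>t. - (z t / s t * exp (-1/6 * s t))) has_real_derivative
     2 * l t * (exp (-1/6 * s t) / (s t * c t) *
       ((1 - c t) * (1 / s t - (-1/6)) - c_rate t))) (at t)" if "t > 0" for t
      using DERIV_minus[OF z_scaled_deriv[OF that, of "-1/6"]] by (rule DERIV_cong) (simp add: algebra_simps)
    have "((\<lambda>t. - (z t / s t * exp (-1/6 * s t))) \<longlongrightarrow> - (\<epsilon> / 3 * exp (-1/6 * 0))) (at_right 0)"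
      by (intro tendsto_intros z_over_s_lim s_lim)
    then show "((\<lambda>t. - (z t / s t * exp (-1/6 * s t))) \<longlongrightarrow> - (\<epsilon> / 3)) (at_right 0)" by simp
    fix t :: real assume t: "0 < t"
    define S C P where "S = s t" and "C = c t" and "P = p t"
    have pos: "S > 0" "C > 0" "P > 0" "C \<le> 1" "P \<le> 2 * (1 - C)"
      using s_pos c_pos p_pos t c_le_1 p_le by (auto simp: S_def C_def P_def)
    have "3 * (S + 2) / (4 * S * (S + 3)) * P \<le> 3 * (S + 2) / (4 * S * (S + 3)) * (2 * (1 - C))"
      using pos by (intro mult_left_mono) auto
    also have "\<dots> = (1 - C) * (3 * (S + 2) / (2 * S * (S + 3)))"
      using pos by (simp add: divide_simps) (simp add: algebra_simps)
    also have "\<dots> \<le> (1 - C) * (1 / S - (-1/6))"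
    proof (rule mult_left_mono)
      have "3 * (S + 2) / (2 * S * (S + 3)) = 1 / S + 1 / (2 * (S + 3))"
        using pos by (simp add: divide_simps)
      moreover have "1 / (2 * (S + 3)) \<le> 1 / 6" using pos by (intro divide_left_mono) auto
      ultimately show "3 * (S + 2) / (2 * S * (S + 3)) \<le> 1 / S - (-1/6)" by simp
    qed (use pos in simp)
    finally show "0 \<le> exp (-1/6 * s t) / (s t * c t) *
       ((1 - c t) * (1 / s t - (-1/6)) - c_rate t)"
      using pos unfolding c_rate_def S_def C_def P_def by (intro mult_nonneg_nonneg) auto
  qed (fact t)
  then have "z t / s t * exp (-1/6 * s t) \<le> \<epsilon> / 3" by simp
  then have "z t / s t * exp (-1/6 * s t) * (s t * exp (s t / 6)) \<le> \<epsilon> / 3 * (s t * exp (s t / 6))"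
    using s_pos[OF t] by (intro mult_right_mono) auto
  moreover have "z t / s t * exp (-1/6 * s t) * (s t * exp (s t / 6)) = z t * exp (-1/6 * s t + s t / 6)"
    using s_pos[OF t] unfolding exp_add by simp
  ultimately show ?thesis by (simp add: mult.assoc)
qed

lemma c_le:
  assumes t: "t > 0"
  shows "c t \<le> 3 * exp (s t / 2) / (\<epsilon> * s t)"
proof -
  have zl: "0 < \<epsilon> / 3 * s t * exp (- s t / 2)" using eps s_pos[OF t] by simp
  have "c t \<le> 1 / z t" unfolding c_eq[OF t] using z_ge[OF t] zl by (intro divide_left_mono) auto
  also have "\<dots> \<le> 1 / (\<epsilon> / 3 * s t * exp (- s t / 2))"
    using z_ge[OF t] zl by (intro divide_left_mono) (auto intro!: mult_pos_pos)
  also have "\<dots> = 3 * exp (s t / 2) / (\<epsilon> * s t)" by (simp add: exp_minus field_simps)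
  finally show ?thesis .
qed

lemma s_mono: "0 < a \<Longrightarrow> a \<le> b \<Longrightarrow> s a \<le> s b"
proof (rule DERIV_nonneg_imp_nondecreasing[where f = s])
  fix x assume "0 < a" "a \<le> x"
  then have x: "x > 0" by simp
  then show "\<exists>y. (s has_real_derivative y) (at x) \<and> 0 \<le> y"
    using s_ode[OF x] l_pos[OF x] by (intro exI[of _ "2 * l x"]) simp
qed

text \<open>Replacing \<open>c\<close> by \<open>0\<close> in the equation for the flux \<open>s (s + 2) p\<close> gives \<open>s\<^sup>2 + 4 s\<close>, that is
\<open>p = (s + 4) / (s + 2)\<close>, which is the abelian instanton. The error of the flux is the integral of
\<open>2 (s + 2) c\<^sup>2\<close>, and the bound \<open>c \<le> 1 / (1 + \<kappa> s)\<close> with \<open>\<kappa>\<close> proportional to \<open>\<epsilon>\<close> makes it of order \<open>1 / \<epsilon>\<close>.\<close>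
lemma p_near_abelian:
  assumes T: "T > 0"
  shows "\<bar>p T - (s T + 4) / (s T + 2)\<bar> \<le> 6 * exp (s T / 2) / (\<epsilon> * s T)"
proof -
  let ?q = "\<lambda>t. s t * (s t + 2) * p t"
  define f where "f t = (s t)\<^sup>2 + 4 * s t - ?q t" for t
  have f_deriv: "(f has_real_derivative 2 * l t * (2 * (s t + 2) * (c t)\<^sup>2)) (at t)" if "t > 0" for t
    unfolding f_def by (rule derivative_eq_intros s_ode flux_deriv that refl)+ (simp add: algebra_simps)
  have "(f \<longlongrightarrow> 0\<^sup>2 + 4 * 0 - 0 * (0 + 2) * 0) (at_right 0)"
    unfolding f_def by (intro tendsto_intros s_lim p_lim0)
  then have f_lim: "(f \<longlongrightarrow> 0) (at_right 0)" by simp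
  have f_nonneg: "0 \<le> f T"
    by (rule ge_limit[OF f_deriv _ f_lim T]) (use s_pos in \<open>auto simp: less_imp_le\<close>)
  define S where "S = s T"
  define \<kappa> where "\<kappa> = exp (- S / 2) / 3 * \<epsilon>"
  have S: "S > 0" using s_pos[OF T] by (simp add: S_def)
  have \<kappa>: "\<kappa> > 0" using eps by (simp add: \<kappa>_def)
  \<comment> \<open>The first term is the integral of \<open>2 (S + 2) / (1 + \<kappa> s)\<^sup>2\<close>, which dominates the derivative of \<open>f\<close>.\<close>
  have "0 \<le> 2 * (S + 2) / \<kappa> * (1 - 1 / (1 + \<kappa> * s T)) - f T"
  proof (rule ge_limit[where f = "\<lambda>t. 2 * (S + 2) / \<kappa> * (1 - 1 / (1 + \<kappa> * s t)) - f t"])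
    show "((\<lambda>t. 2 * (S + 2) / \<kappa> * (1 - 1 / (1 + \<kappa> * s t)) - f t) has_real_derivative
        2 * l t * (2 * (S + 2) * (1 / (1 + \<kappa> * s t))\<^sup>2 - 2 * (s t + 2) * (c t)\<^sup>2)) (at t)" if "t > 0" for t
    proof -
      have "1 + \<kappa> * s t > 0" using \<kappa> s_pos[OF that] by (simp add: add_pos_pos)
      then have n: "1 + \<kappa> * s t \<noteq> 0" by simp
      show ?thesis
        by (rule derivative_eq_intros s_ode f_deriv that refl n)+
          (use n \<kappa> in \<open>simp add: divide_simps, simp add: algebra_simps power2_eq_square\<close>)
    qed
    have "((\<lambda>t. 2 * (S + 2) / \<kappa> * (1 - 1 / (1 + \<kappa> * s t)) - f t) \<longlongrightarrow>
        2 * (S + 2) / \<kappa> * (1 - 1 / (1 + \<kappa> * 0)) - 0) (at_right 0)"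
      by (intro tendsto_intros s_lim f_lim) simp
    then show "((\<lambda>t. 2 * (S + 2) / \<kappa> * (1 - 1 / (1 + \<kappa> * s t)) - f t) \<longlongrightarrow> 0) (at_right 0)" by simp
    fix t assume t: "0 < t" "t \<le> T"
    have le: "s t \<le> S" unfolding S_def using t by (rule s_mono)
    have pos: "s t > 0" "c t > 0" using s_pos c_pos t by auto
    have "\<kappa> * s t \<le> \<epsilon> / 3 * s t * exp (- s t / 2)"
      using le pos eps by (simp add: \<kappa>_def)
    also have "\<dots> \<le> z t" by (rule z_ge[OF t(1)])
    finally have "c t \<le> 1 / (1 + \<kappa> * s t)"
      unfolding c_eq[OF t(1)] using \<kappa> pos z_nonneg[OF t(1)]
      by (intro divide_left_mono) (auto intro!: mult_pos_pos add_pos_nonneg)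
    then have "(c t)\<^sup>2 \<le> (1 / (1 + \<kappa> * s t))\<^sup>2" using pos by (intro power_mono) auto
    then have "2 * (s t + 2) * (c t)\<^sup>2 \<le> 2 * (S + 2) * (1 / (1 + \<kappa> * s t))\<^sup>2"
      using le pos by (intro mult_mono) auto
    then show "0 \<le> 2 * (S + 2) * (1 / (1 + \<kappa> * s t))\<^sup>2 - 2 * (s t + 2) * (c t)\<^sup>2" by simp
  qed (fact T)
  moreover have "2 * (S + 2) / \<kappa> * (1 - 1 / (1 + \<kappa> * s T)) \<le> 2 * (S + 2) / \<kappa> * 1"
    using \<kappa> S by (intro mult_left_mono) (auto simp: S_def)
  ultimately have f_le: "f T \<le> 2 * (S + 2) / \<kappa>" by simp
  have eq: "p T - (S + 4) / (S + 2) = - (f T / (S * (S + 2)))"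
    using S unfolding f_def S_def[symmetric]
    by (simp add: divide_simps) (simp add: algebra_simps power2_eq_square)
  have "\<bar>p T - (S + 4) / (S + 2)\<bar> = f T / (S * (S + 2))"
    unfolding eq using f_nonneg S by simp
  also have "\<dots> \<le> 2 * (S + 2) / \<kappa> / (S * (S + 2))"
    using f_le S by (intro divide_right_mono) auto
  also have "\<dots> = 6 * exp (S / 2) / (\<epsilon> * S)"
    using S eps by (simp add: \<kappa>_def exp_minus divide_simps)
  finally show ?thesis unfolding S_def .
qed

text \<open>The hypotheses are the two-sided bounds on \<open>u\<^sub>1 - 1\<close>. The estimate is relative to the leading term
\<open>\<epsilon> t\<^sup>2 / 2\<close>, so after replacing \<open>t\<close> by \<open>t / sqrt \<epsilon>\<close> only the vanishing factor depends on \<open>\<epsilon>\<close>.\<close>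
lemma z_near_quadratic:
  assumes t: "t > 0" and up: "s t \<le> 3/2 * t\<^sup>2" and low: "t\<^sup>2 * ((s t + 3) / (s t + 2)) \<le> s t"
  shows "\<bar>z t - \<epsilon> * t\<^sup>2 / 2\<bar> \<le> \<epsilon> * t\<^sup>2 / 2 * (exp (s t / 6) - 1 + s t)"
proof -
  define S Q where "S = s t" and "Q = \<epsilon> * t\<^sup>2 / 2"
  have S: "S > 0" using s_pos[OF t] by (simp add: S_def)
  have Q: "Q \<ge> 0" using eps by (simp add: Q_def)
  have e1: "exp (S / 6) \<ge> 1" using S by simp
  have "z t \<le> \<epsilon> / 3 * S * exp (S / 6)" using z_le[OF t] by (simp add: S_def)
  also have "\<dots> \<le> Q * exp (S / 6)"
  proof (rule mult_right_mono)
    have "\<epsilon> * S \<le> \<epsilon> * (3/2 * t\<^sup>2)" using up eps by (intro mult_left_mono) (auto simp: S_def)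
    then show "\<epsilon> / 3 * S \<le> Q" by (simp add: Q_def)
  qed simp
  finally have upper: "z t - Q \<le> Q * (exp (S / 6) - 1)" by (simp add: algebra_simps)
  have "Q * (1 - S) \<le> Q * ((1 - S / (3 * (S + 2))) * exp (- S / 2))"
  proof (rule mult_left_mono[OF _ Q])
    define x where "x = S / (3 * (S + 2))"
    have x: "0 \<le> x" "x \<le> S / 6" "x \<le> 1"
      unfolding x_def using S by (auto intro!: divide_left_mono simp: divide_simps)
    have e: "1 - S / 2 \<le> exp (- S / 2)" "exp (- S / 2) \<le> 1"
      using exp_ge_add_one_self[of "- S / 2"] S by simp_all
    have "(1 - S / (3 * (S + 2))) * exp (- S / 2) = exp (- S / 2) - x * exp (- S / 2)"
      by (simp add: x_def algebra_simps)
    moreover have "x * exp (- S / 2) \<le> x" using x e by (simp add: mult_left_le)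
    ultimately show "1 - S \<le> (1 - S / (3 * (S + 2))) * exp (- S / 2)"
      using x e S by linarith
  qed
  also have "Q * ((1 - S / (3 * (S + 2))) * exp (- S / 2)) =
      \<epsilon> / 3 * (t\<^sup>2 * ((S + 3) / (S + 2))) * exp (- S / 2)"
  proof -
    define y where "y = (S + 3) / (S + 2)"
    have "1 - S / (3 * (S + 2)) = 2/3 * y"
      using S by (simp add: y_def divide_simps)
    then show ?thesis unfolding Q_def y_def[symmetric] by simp
  qed
  also have "\<dots> \<le> \<epsilon> / 3 * S * exp (- S / 2)"
    using low eps unfolding S_def[symmetric] by (intro mult_right_mono mult_left_mono) auto
  also have "\<dots> \<le> z t" using z_ge[OF t] by (simp add: S_def)
  finally have lower: "Q - z t \<le> Q * S" by (simp add: algebra_simps)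
  have "0 \<le> Q * S" "0 \<le> Q * (exp (S / 6) - 1)" using Q S e1 by auto
  with upper lower have "\<bar>z t - Q\<bar> \<le> Q * (exp (S / 6) - 1) + Q * S" by linarith
  also have "\<dots> = Q * (exp (S / 6) - 1 + S)" by (simp add: algebra_simps)
  finally show ?thesis unfolding Q_def S_def .
qed

text \<open>The map from \<open>z\<close> to \<open>c = 1 / (1 + z)\<close> is 1-Lipschitz for \<open>z \<ge> 0\<close>, and \<open>p\<close> differs from \<open>2 (1 - c)\<close> by
at most \<open>s\<close>.\<close>
lemma near_bpst:
  assumes t: "t > 0" and z: "\<bar>z t - \<epsilon> * t\<^sup>2 / 2\<bar> \<le> B"
  shows "\<bar>c t - 2 / (2 + \<epsilon> * t\<^sup>2)\<bar> \<le> B"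
    and "\<bar>p t - (2 - 4 / (2 + \<epsilon> * t\<^sup>2))\<bar> \<le> 2 * B + s t"
proof -
  define Q where "Q = \<epsilon> * t\<^sup>2 / 2"
  have Q: "Q \<ge> 0" using eps by (simp add: Q_def)
  note z0 = z_nonneg[OF t]
  have eq: "2 / (2 + \<epsilon> * t\<^sup>2) = 1 / (1 + Q)" using Q by (simp add: Q_def divide_simps)
  have "1 / (1 + z t) - 1 / (1 + Q) = (Q - z t) / ((1 + z t) * (1 + Q))"
    using z0 Q by (simp add: divide_simps)
  then have "\<bar>1 / (1 + z t) - 1 / (1 + Q)\<bar> = \<bar>z t - Q\<bar> / ((1 + z t) * (1 + Q))"
    using z0 Q by (simp add: abs_mult abs_minus_commute)
  also have "\<dots> \<le> \<bar>z t - Q\<bar> / 1"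
  proof (rule divide_left_mono)
    have "1 * 1 \<le> (1 + z t) * (1 + Q)" using z0 Q by (intro mult_mono) auto
    then show "1 \<le> (1 + z t) * (1 + Q)" by simp
  qed (use z0 Q in auto)
  finally show c: "\<bar>c t - 2 / (2 + \<epsilon> * t\<^sup>2)\<bar> \<le> B"
    using z unfolding c_eq[OF t] eq Q_def by simp
  have "2/3 * s t * (1 - c t) \<le> s t * 1"
    using s_pos[OF t] c_pos[OF t] c_le_1[OF t] by (intro mult_mono) auto
  then have "\<bar>p t - 2 * (1 - c t)\<bar> \<le> s t"
    using p_le[OF t] p_ge[OF t] s_pos[OF t] by linarith
  moreover have "p t - (2 - 4 / (2 + \<epsilon> * t\<^sup>2)) =
      (p t - 2 * (1 - c t)) - 2 * (c t - 2 / (2 + \<epsilon> * t\<^sup>2))" by simp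
  ultimately show "\<bar>p t - (2 - 4 / (2 + \<epsilon> * t\<^sup>2))\<bar> \<le> 2 * B + s t"
    using c by (simp only: abs_le_iff) argo
qed

end

section \<open>From invariant instantons to the radial system\<close>

lemma quotient_lim_of_expansion:
  fixes f :: "real \<Rightarrow> real"
  assumes "(\<lambda>t. f t - (b + k * t\<^sup>2)) \<in> O[at_right 0](\<lambda>t. t ^ 4)"
  shows "((\<lambda>t. (f t - b) / t\<^sup>2) \<longlongrightarrow> k) (at_right 0)"
proof -
  have "(\<lambda>t::real. t ^ 4) \<in> o[at_right 0](\<lambda>t. t\<^sup>2)" proof (rule smalloI_tendsto)
    have "((\<lambda>t::real. t\<^sup>2) \<longlongrightarrow> 0\<^sup>2) (at_right 0)" by (intro tendsto_intros)
    moreover have "t ^ 4 / t\<^sup>2 = t\<^sup>2" for t :: real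
      by (simp add: power2_eq_square power4_eq_xxxx)
    ultimately show "((\<lambda>t::real. t ^ 4 / t\<^sup>2) \<longlongrightarrow> 0) (at_right 0)" by simp
    show "eventually (\<lambda>t::real. t\<^sup>2 \<noteq> 0) (at_right 0)"
      using eventually_at_right_less[of "0::real"] by eventually_elim simp
  qed
  with assms have "(\<lambda>t. f t - (b + k * t\<^sup>2)) \<in> o[at_right 0](\<lambda>t. t\<^sup>2)"
    by (rule landau_o.big_small_trans)
  then have "((\<lambda>t. (f t - (b + k * t\<^sup>2)) / t\<^sup>2) \<longlongrightarrow> 0) (at_right 0)"
    by (rule smalloD_tendsto)
  from tendsto_add[OF this tendsto_const[of k]]
  have "((\<lambda>t. (f t - (b + k * t\<^sup>2)) / t\<^sup>2 + k) \<longlongrightarrow> k) (at_right 0)" by simp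
  moreover have "eventually (\<lambda>t. (f t - (b + k * t\<^sup>2)) / t\<^sup>2 + k = (f t - b) / t\<^sup>2) (at_right 0)"
    using eventually_at_right_less[of "0::real"]
    by eventually_elim (simp add: divide_simps)
  ultimately show ?thesis by (rule Lim_transform_eventually)
qed

lemma bounded_linear_coE: "bounded_linear coE1" "bounded_linear coE2"
  unfolding coE1_def[abs_def] coE2_def[abs_def]
  by (intro bounded_linear_intros bounded_linear_Re[THEN bounded_linear_compose]
      bounded_linear_Im[THEN bounded_linear_compose] bounded_linear_vec_nth[THEN bounded_linear_compose]
      bounded_linear_vec_nth)+

lemma instanton_coefficients_differentiable:
  assumes "instanton up lam mu (conn_form a0 a2)" "t > 0"
  shows "a0 differentiable at t" "a2 differentiable at t"
proof -
  have d: "(\<lambda>t. conn_form a0 a2 t x) differentiable at t" if "x \<in> tangent" for x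
  proof -
    have "Ck_on (Suc 0) (\<lambda>t. conn_form a0 a2 t x) {0<..}"
      using assms(1) that unfolding instanton_def smooth_on_def by blast
    then show ?thesis using assms(2) by simp
  qed
  have "(\<lambda>t. L (conn_form a0 a2 t x)) differentiable at t"
    if "bounded_linear L" "x \<in> tangent" for L :: "mat2 \<Rightarrow> real" and x
    using d[OF that(2)] bounded_linear.has_derivative[OF that(1)]
    unfolding differentiable_def by blast
  from this[OF bounded_linear_coE(1) e_tangent(2)] this[OF bounded_linear_coE(2) e_tangent(5)]
  show "a0 differentiable at t" "a2 differentiable at t"
    by (simp_all add: conn_form_def e_defs)
qed

text \<open>Near \<open>t = 0\<close> the expansions of \<open>a0\<close> and \<open>a2\<close> are in powers of \<open>t\<close>; they are converted to the variable
\<open>s\<close> by means of \<open>s / t\<^sup>2 \<rightarrow> 3/2\<close>.\<close>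
lemma is_R_radial_instanton:
  assumes C: "candelas_de_la_ossa up lam mu" and R: "is_R up lam mu \<epsilon> a0 a2" and eps: "\<epsilon> > 0"
  shows "radial_instanton (\<lambda>t. up t - 1) lam (\<lambda>t. a0 t + 1) a2 \<epsilon>"
proof
  fix t :: real assume t: "t > 0"
  have u: "up t > 1" and l: "lam t > 0" and m: "mu t > 0"
    and lu: "(up has_real_derivative 2 * lam t) (at t)"
    using C t candelas_gt_1[OF C t] by (auto simp: candelas_de_la_ossa_def)
  from lu show "((\<lambda>t. up t - 1) has_real_derivative 2 * lam t) (at t)"
    by (auto intro!: derivative_eq_intros)
  show "up t - 1 > 0" "lam t > 0" using u l by auto
  have I: "instanton up lam mu (conn_form a0 a2)" using R by (simp add: is_R_def)
  obtain a0' a2' where d0: "(a0 has_real_derivative a0') (at t)" and d2: "(a2 has_real_derivative a2') (at t)"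
    using instanton_coefficients_differentiable[OF I t] by (auto simp: real_differentiable_def)
  note odes = instanton_odes[OF I t d0 d2 u l m]
  define S where "S = up t - 1"
  have S: "S > 0" "up t = S + 1" using u by (auto simp: S_def)
  have u2: "(up t)\<^sup>2 - 1 = S * (S + 2)" by (simp add: S algebra_simps power2_eq_square)
  have "a0' = - 4 * lam t * (a0 t * up t - 1 + (a2 t)\<^sup>2 * (up t + 1)) / (S * (S + 2))"
    using odes(1) S(1) unfolding u2 by (subst nonzero_eq_divide_eq) auto
  also have "\<dots> = 2 * lam t * (2 * (1 - (a2 t)\<^sup>2) / S - 2 * (1 + S) / (S * (S + 2)) * (a0 t + 1))"
    unfolding S(2) using S(1) by (simp add: divide_simps) (simp add: algebra_simps)
  finally show "((\<lambda>t. a0 t + 1) has_real_derivative 2 * lam t * (2 * (1 - (a2 t)\<^sup>2) / (up t - 1)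
      - 2 * (1 + (up t - 1)) / ((up t - 1) * (up t - 1 + 2)) * (a0 t + 1))) (at t)"
    using d0 unfolding S_def by (auto intro!: derivative_eq_intros)
  have "(lam t)\<^sup>2 = S * (S + 3) / (S + 2)"
    unfolding candelas_lam[OF C t] by (simp add: S ac_simps)
  then have L: "lam t * (3 * (S + 2) / (4 * S * (S + 3))) = 3 / (4 * lam t)"
    using S(1) l by (simp add: divide_simps power2_eq_square) (simp add: algebra_simps)
  have "a2' = - (3 * a2 t * (a0 t + 1)) / (2 * lam t)"
    using odes(2) l by (simp add: field_simps)
  also have "\<dots> = - 2 * (3 / (4 * lam t)) * (a2 t * (a0 t + 1))" by simp
  also have "\<dots> = 2 * lam t * (- (3 * (S + 2) / (4 * S * (S + 3)) * (a2 t * (a0 t + 1))))"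
    unfolding L[symmetric] by simp
  finally show "(a2 has_real_derivative 2 * lam t * (- (3 * (up t - 1 + 2) /
      (4 * (up t - 1) * (up t - 1 + 3)) * (a2 t * (a0 t + 1))))) (at t)"
    using d2 unfolding S_def by simp
next
  show "((\<lambda>t. up t - 1) \<longlongrightarrow> 0) (at_right 0)" by (rule candelas_lim[OF C])
  have change: "((\<lambda>t. f t / (up t - 1)) \<longlongrightarrow> k / (3/2)) (at_right 0)"
    if "((\<lambda>t. f t / t\<^sup>2) \<longlongrightarrow> k) (at_right 0)" for f k
  proof (rule Lim_transform_eventually)
    show "((\<lambda>t. (f t / t\<^sup>2) / ((up t - 1) / t\<^sup>2)) \<longlongrightarrow> k / (3/2)) (at_right 0)"
      by (intro tendsto_intros that candelas_depth_lim[OF C]) simp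
    show "eventually (\<lambda>t. (f t / t\<^sup>2) / ((up t - 1) / t\<^sup>2) = f t / (up t - 1)) (at_right 0)"
      using eventually_at_right_less[of "0::real"] by eventually_elim simp
  qed
  have "((\<lambda>t. (a0 t - (-1)) / t\<^sup>2) \<longlongrightarrow> \<epsilon>) (at_right 0)"
    by (rule quotient_lim_of_expansion) (use R in \<open>simp add: is_R_def\<close>)
  from change[OF this] show "((\<lambda>t. (a0 t + 1) / (up t - 1)) \<longlongrightarrow> 2 * \<epsilon> / 3) (at_right 0)"
    by (simp add: mult.commute)
  have "((\<lambda>t. (a2 t - 1) / t\<^sup>2) \<longlongrightarrow> - \<epsilon> / 2) (at_right 0)"
    by (rule quotient_lim_of_expansion) (use R in \<open>simp add: is_R_def\<close>)
  moreover have "- ((a2 t - 1) / (up t - 1)) = (1 - a2 t) / (up t - 1)" for t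
    by (metis minus_divide_left minus_diff_eq)
  ultimately show "((\<lambda>t. (1 - a2 t) / (up t - 1)) \<longlongrightarrow> \<epsilon> / 3) (at_right 0)"
    using tendsto_minus[OF change[of "\<lambda>t. a2 t - 1" "- \<epsilon> / 2"]] by simp
qed (fact eps)

section \<open>The basic instanton on the fibres\<close>

text \<open>Coinduction for smoothness: a class of functions that contains the directional derivatives of its
members consists of smooth functions.\<close>
lemma smooth_on_coinduct:
  assumes f: "P f"
    and step: "\<And>f. P f \<Longrightarrow> \<exists>f'. (\<forall>x. (f has_derivative f' x) (at x)) \<and> (\<forall>w. P (\<lambda>x. f' x w))"
  shows "smooth_on f UNIV"
proof -
  have "Ck_on n f UNIV" if "P f" for n f
    using that
  proof (induction n arbitrary: f)
    case 0
    obtain f' where "\<forall>x. (f has_derivative f' x) (at x)" using step[OF 0] by blast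
    then show ?case
      by (auto intro!: continuous_at_imp_continuous_on has_derivative_continuous)
  next
    case (Suc n)
    obtain f' where f': "\<And>x. (f has_derivative f' x) (at x)" "\<And>w. P (\<lambda>x. f' x w)"
      using step[OF Suc.prems] by blast
    have "f' x = frechet_derivative f (at x)" for x
      using frechet_derivative_at f'(1) by metis
    then have "P (\<lambda>x. frechet_derivative f (at x) w)" for w using f'(2)[of w] by simp
    with f' Suc.IH show ?case by (auto simp: differentiable_def)
  qed
  with f show ?thesis by (simp add: smooth_on_def)
qed

text \<open>A class of functions large enough for the basic instanton and closed under directional derivatives.
It contains the functions \<open>N(x) / (2 + |x|\<^sup>2) ^ k\<close> with \<open>N\<close> polynomial.\<close>
inductive bpst_coeff :: "(real^4 \<Rightarrow> mat2) \<Rightarrow> bool" where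
  const: "bpst_coeff (\<lambda>x. M)"
| add: "bpst_coeff f \<Longrightarrow> bpst_coeff g \<Longrightarrow> bpst_coeff (\<lambda>x. f x + g x)"
| scale: "bpst_coeff f \<Longrightarrow> bpst_coeff (\<lambda>x. c *\<^sub>R f x)"
| coord: "bpst_coeff f \<Longrightarrow> bpst_coeff (\<lambda>x. (x \<bullet> b) *\<^sub>R f x)"
| rho: "bpst_coeff f \<Longrightarrow> bpst_coeff (\<lambda>x. inverse (2 + x \<bullet> x) *\<^sub>R f x)"

lemma pos_2_inner: "0 < 2 + x \<bullet> (x :: 'a :: real_inner)" "2 + x \<bullet> x \<noteq> 0"
  using inner_ge_zero[of x] by linarith+

lemma bpst_coeff_derivative:
  "bpst_coeff f \<Longrightarrow> \<exists>f'. (\<forall>x. (f has_derivative f' x) (at x)) \<and> (\<forall>w. bpst_coeff (\<lambda>x. f' x w))"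
proof (induction rule: bpst_coeff.induct)
  case (const M)
  show ?case by (rule exI[of _ "\<lambda>x w. 0"]) (auto intro: bpst_coeff.const)
next
  case (add f g)
  then obtain f' g' where
    "\<And>x. (f has_derivative f' x) (at x)" "\<And>w. bpst_coeff (\<lambda>x. f' x w)"
    "\<And>x. (g has_derivative g' x) (at x)" "\<And>w. bpst_coeff (\<lambda>x. g' x w)" by blast
  then show ?case
    by (intro exI[of _ "\<lambda>x w. f' x w + g' x w"]) (auto intro: has_derivative_add bpst_coeff.add)
next
  case (scale f c)
  then obtain f' where "\<And>x. (f has_derivative f' x) (at x)" "\<And>w. bpst_coeff (\<lambda>x. f' x w)" by blast
  then show ?case
    by (intro exI[of _ "\<lambda>x w. c *\<^sub>R f' x w"])
      (auto intro: has_derivative_scaleR_right bpst_coeff.scale)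
next
  case (coord f b)
  then obtain f' where f': "\<And>x. (f has_derivative f' x) (at x)" "\<And>w. bpst_coeff (\<lambda>x. f' x w)" by blast
  show ?case
  proof (intro exI conjI allI)
    show "((\<lambda>x. (x \<bullet> b) *\<^sub>R f x) has_derivative
        (\<lambda>w. (x \<bullet> b) *\<^sub>R f' x w + (w \<bullet> b) *\<^sub>R f x)) (at x)" for x
      by (auto intro!: derivative_eq_intros f')
    show "bpst_coeff (\<lambda>x. (x \<bullet> b) *\<^sub>R f' x w + (w \<bullet> b) *\<^sub>R f x)" for w
      by (intro bpst_coeff.intros f' coord)
  qed
next
  case (rho f)
  then obtain f' where f': "\<And>x. (f has_derivative f' x) (at x)" "\<And>w. bpst_coeff (\<lambda>x. f' x w)" by blast
  show ?case
  proof (intro exI conjI allI)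
    show "((\<lambda>x. inverse (2 + x \<bullet> x) *\<^sub>R f x) has_derivative
        (\<lambda>w. inverse (2 + x \<bullet> x) *\<^sub>R f' x w +
          inverse (2 + x \<bullet> x) *\<^sub>R inverse (2 + x \<bullet> x) *\<^sub>R (x \<bullet> (- 2 *\<^sub>R w)) *\<^sub>R f x)) (at x)" for x
      by (rule derivative_eq_intros refl f' | simp add: pos_2_inner)+
        (auto simp: fun_eq_iff algebra_simps inner_commute power2_eq_square)
    show "bpst_coeff (\<lambda>x. inverse (2 + x \<bullet> x) *\<^sub>R f' x w +
          inverse (2 + x \<bullet> x) *\<^sub>R inverse (2 + x \<bullet> x) *\<^sub>R (x \<bullet> (- 2 *\<^sub>R w)) *\<^sub>R f x)" for w
      by (intro bpst_coeff.intros f' rho)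
  qed
qed

lemma bpst_coeff_smooth: "bpst_coeff f \<Longrightarrow> smooth_on f UNIV"
  using smooth_on_coinduct[of bpst_coeff f] bpst_coeff_derivative by blast

text \<open>The imaginary part of the quaternion \<open>x w\<^sup>*\<close>.\<close>
definition im_prod :: "real^4 \<Rightarrow> real^4 \<Rightarrow> mat2" where
  "im_prod x w = (1/2) *\<^sub>R (quat x ** cadj (quat w) - quat w ** cadj (quat x))"

text \<open>The basic instanton of Belavin, Polyakov, Schwarz and Tyupkin, centred at \<open>0\<close>. The constant \<open>2\<close> comes
from \<open>a2 = 1 - \<epsilon>/2 t\<^sup>2 + O(t\<^sup>4)\<close> after rescaling \<open>\<epsilon>\<close> to \<open>1\<close>.\<close>
definition bpst :: conn4 where
  "bpst x w = inverse (2 + x \<bullet> x) *\<^sub>R im_prod x w"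

lemma quat_nth:
  "quat x $ 1 $ 1 = Complex (x$1) (x$2)" "quat x $ 1 $ 2 = Complex (x$3) (x$4)"
  "quat x $ 2 $ 1 = Complex (- x$3) (x$4)" "quat x $ 2 $ 2 = Complex (x$1) (- x$2)"
  by (simp_all add: quat_def E1_def E2_def E3_def mat_def complex_eq_iff)

lemma cadj_nth: "cadj M $ i $ j = cnj (M $ j $ i)"
  by (simp add: cadj_def)

lemma inner_4: "(x::real^4) \<bullet> y = x$1 * y$1 + x$2 * y$2 + x$3 * y$3 + x$4 * y$4"
  by (simp add: inner_vec_def sum_4)

lemma im_prod_expand:
  "im_prod x w = (x$2*w$1 - x$1*w$2 - x$3*w$4 + x$4*w$3) *\<^sub>R E1 +
     (x$3*w$1 - x$1*w$3 - x$4*w$2 + x$2*w$4) *\<^sub>R E2 + (x$4*w$1 - x$1*w$4 - x$2*w$3 + x$3*w$2) *\<^sub>R E3"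
  by (simp add: im_prod_def mat2_eq mat2_mult_nth cadj_nth quat_nth E1_def E2_def E3_def complex_eq_iff)

lemma lie_E_comb:
  "lie (a *\<^sub>R E1 + b *\<^sub>R E2 + c *\<^sub>R E3) (a' *\<^sub>R E1 + b' *\<^sub>R E2 + c' *\<^sub>R E3) =
    (2 * (b * c' - c * b')) *\<^sub>R E1 + (2 * (c * a' - a * c')) *\<^sub>R E2 + (2 * (a * b' - b * a')) *\<^sub>R E3"
  by (simp add: lie_def mat2_eq mat2_mult_nth E1_def E2_def E3_def complex_eq_iff algebra_simps)

lemma su2_comb: "a *\<^sub>R E1 + b *\<^sub>R E2 + c *\<^sub>R E3 \<in> su2"
  by (simp add: su2_def cadj_def trace_def sum_2 mat2_eq E1_def E2_def E3_def complex_eq_iff)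

lemma linear_bpst: "linear (bpst x)"
  by (rule linearI) (simp_all add: bpst_def im_prod_expand algebra_simps)

lemma su2_scaleR: "X \<in> su2 \<Longrightarrow> r *\<^sub>R X \<in> su2"
  by (subst su2_expansion[of X]) (simp_all add: scaleR_add_right su2_comb)

lemma su2_conn4_bpst: "su2_conn4 bpst"
  unfolding su2_conn4_def
proof (intro allI conjI)
  show "linear (bpst x)" "range (bpst x) \<subseteq> su2" for x
    by (auto simp: linear_bpst) (simp add: bpst_def im_prod_expand su2_comb su2_scaleR)
  show "smooth_on (\<lambda>x. bpst x w) UNIV" for w
  proof (rule bpst_coeff_smooth)
    have eq: "im_prod x w = (\<Sum>i\<in>UNIV. (x \<bullet> axis i 1) *\<^sub>R im_prod (axis i 1) w)" for x
    proof -
      have ax: "x \<bullet> axis i 1 = x $ i" for i by (simp add: inner_axis)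
      show ?thesis unfolding sum_4 im_prod_expand ax by (simp add: axis_def algebra_simps)
    qed
    have "(\<lambda>x. bpst x w) =
        (\<lambda>x. inverse (2 + x \<bullet> x) *\<^sub>R (\<Sum>i\<in>UNIV. (x \<bullet> axis i 1) *\<^sub>R im_prod (axis i 1) w))"
      unfolding bpst_def by (rule ext) (simp only: eq[symmetric])
    then show "bpst_coeff (\<lambda>x. bpst x w)"
      unfolding sum_4 by (simp only:) (intro bpst_coeff.intros)
  qed
qed

text \<open>The curvature is a multiple of the imaginary part of \<open>v w\<^sup>*\<close>, that is of \<open>dx \<and> dx\<^sup>*\<close>, which is self-dual
for the basis \<open>1, i, j, k\<close> and therefore anti-self-dual for the complex orientation.\<close>
lemma curvature4_bpst: "curvature4 bpst x v w = (4 * (inverse (2 + x \<bullet> x))\<^sup>2) *\<^sub>R im_prod v w"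
proof -
  let ?r = "inverse (2 + x \<bullet> x)"
  have D: "((\<lambda>y. bpst y w) has_derivative
      (\<lambda>v. ?r *\<^sub>R im_prod v w - (2 * (x \<bullet> v) * ?r\<^sup>2) *\<^sub>R im_prod x w)) (at x)" for w
  proof -
    have "linear (\<lambda>y. im_prod y w)"
      by (rule linearI) (simp_all add: im_prod_expand algebra_simps)
    then have d: "((\<lambda>y. im_prod y w) has_derivative (\<lambda>y. im_prod y w)) (at x)"
      by (intro linear_imp_has_derivative)
    show ?thesis unfolding bpst_def
      by (rule derivative_eq_intros refl d | simp add: pos_2_inner)+
        (simp add: fun_eq_iff algebra_simps inner_commute power2_eq_square)
  qed
  have fd: "frechet_derivative (\<lambda>y. bpst y w) (at x) v =
      ?r *\<^sub>R im_prod v w - (2 * (x \<bullet> v) * ?r\<^sup>2) *\<^sub>R im_prod x w" for v w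
    unfolding frechet_derivative_at[OF D, symmetric] ..
  have skew: "im_prod w v = - im_prod v w" for v w
    unfolding im_prod_def scaleR_minus_right[symmetric] minus_diff_eq ..
  have key: "(2 * (2 + x \<bullet> x)) *\<^sub>R im_prod v w - (2 * (x \<bullet> v)) *\<^sub>R im_prod x w + (2 * (x \<bullet> w)) *\<^sub>R im_prod x v
      + lie (im_prod x v) (im_prod x w) = 4 *\<^sub>R im_prod v w"
  proof -
    define a1 a2 a3 where "a1 = v$2 * w$1 - v$1 * w$2 - v$3 * w$4 + v$4 * w$3"
      and "a2 = v$3 * w$1 - v$1 * w$3 - v$4 * w$2 + v$2 * w$4" and "a3 = v$4 * w$1 - v$1 * w$4 - v$2 * w$3 + v$3 * w$2"
    define b1 b2 b3 where "b1 = x$2 * v$1 - x$1 * v$2 - x$3 * v$4 + x$4 * v$3"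
      and "b2 = x$3 * v$1 - x$1 * v$3 - x$4 * v$2 + x$2 * v$4" and "b3 = x$4 * v$1 - x$1 * v$4 - x$2 * v$3 + x$3 * v$2"
    define c1 c2 c3 where "c1 = x$2 * w$1 - x$1 * w$2 - x$3 * w$4 + x$4 * w$3"
      and "c2 = x$3 * w$1 - x$1 * w$3 - x$4 * w$2 + x$2 * w$4" and "c3 = x$4 * w$1 - x$1 * w$4 - x$2 * w$3 + x$3 * w$2"
    note defs = a1_def a2_def a3_def b1_def b2_def b3_def c1_def c2_def c3_def
    have im: "im_prod v w = a1 *\<^sub>R E1 + a2 *\<^sub>R E2 + a3 *\<^sub>R E3"
      "im_prod x v = b1 *\<^sub>R E1 + b2 *\<^sub>R E2 + b3 *\<^sub>R E3"
      "im_prod x w = c1 *\<^sub>R E1 + c2 *\<^sub>R E2 + c3 *\<^sub>R E3"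
      unfolding defs by (rule im_prod_expand)+
    define xx xv xw where "xx = x \<bullet> x" and "xv = x \<bullet> v" and "xw = x \<bullet> w"
    have 1: "xx * a1 - xv * c1 + xw * b1 + b2 * c3 - b3 * c2 = 0"
      unfolding defs xx_def xv_def xw_def inner_4 by algebra
    have 2: "xx * a2 - xv * c2 + xw * b2 + b3 * c1 - b1 * c3 = 0"
      unfolding defs xx_def xv_def xw_def inner_4 by algebra
    have 3: "xx * a3 - xv * c3 + xw * b3 + b1 * c2 - b2 * c1 = 0"
      unfolding defs xx_def xv_def xw_def inner_4 by algebra
    have "(2 * (2 + xx)) *\<^sub>R im_prod v w - (2 * xv) *\<^sub>R im_prod x w + (2 * xw) *\<^sub>R im_prod x v
        + lie (im_prod x v) (im_prod x w) = 4 *\<^sub>R im_prod v w +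
        (2 * (xx * a1 - xv * c1 + xw * b1 + b2 * c3 - b3 * c2)) *\<^sub>R E1 +
        (2 * (xx * a2 - xv * c2 + xw * b2 + b3 * c1 - b1 * c3)) *\<^sub>R E2 +
        (2 * (xx * a3 - xv * c3 + xw * b3 + b1 * c2 - b2 * c1)) *\<^sub>R E3"
      unfolding im lie_E_comb
      by (simp only: scaleR_add_right scaleR_add_left scaleR_diff_left scaleR_scaleR distrib_left right_diff_distrib)
        (simp add: algebra_simps)
    then have "(2 * (2 + xx)) *\<^sub>R im_prod v w - (2 * xv) *\<^sub>R im_prod x w + (2 * xw) *\<^sub>R im_prod x v
        + lie (im_prod x v) (im_prod x w) = 4 *\<^sub>R im_prod v w"
      by (simp only: 1 2 3 mult_zero_right scaleR_zero_left add_0_right)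
    then show ?thesis by (simp only: xx_def xv_def xw_def)
  qed
  have "curvature4 bpst x v w = ?r\<^sup>2 *\<^sub>R ((2 * (2 + x \<bullet> x)) *\<^sub>R im_prod v w
      - (2 * (x \<bullet> v)) *\<^sub>R im_prod x w + (2 * (x \<bullet> w)) *\<^sub>R im_prod x v + lie (im_prod x v) (im_prod x w))"
  proof -
    have *: "r *\<^sub>R a - (p * r\<^sup>2) *\<^sub>R b - (r *\<^sub>R (- a) - (q * r\<^sup>2) *\<^sub>R c) + r\<^sup>2 *\<^sub>R l =
        r\<^sup>2 *\<^sub>R ((2 * N) *\<^sub>R a - p *\<^sub>R b + q *\<^sub>R c + l)"
      if "r * N = 1" for r N p q :: real and a b c l :: mat2
    proof -
      have "r\<^sup>2 * (2 * N) = 2 * r * (r * N)" by (simp add: power2_eq_square)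
      then have "r\<^sup>2 * (2 * N) = r + r" using that by simp
      moreover have "r\<^sup>2 *\<^sub>R ((2 * N) *\<^sub>R a - p *\<^sub>R b + q *\<^sub>R c + l) =
          (r\<^sup>2 * (2 * N)) *\<^sub>R a - (p * r\<^sup>2) *\<^sub>R b + (q * r\<^sup>2) *\<^sub>R c + r\<^sup>2 *\<^sub>R l"
        by (simp add: scaleR_add_right scaleR_diff_right mult.commute)
      ultimately show ?thesis
        by (simp only: that mult_1_right scaleR_add_left) simp
    qed
    have l: "lie (bpst x v) (bpst x w) = ?r\<^sup>2 *\<^sub>R lie (im_prod x v) (im_prod x w)"
      unfolding bpst_def by (simp add: power2_eq_square)
    show ?thesis unfolding curvature4_def fd l skew[of w v]
      by (rule *) (use pos_2_inner(2)[of x] in simp)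
  qed
  then show ?thesis unfolding key by simp
qed

lemma asd4_bpst: "asd4 bpst"
  unfolding asd4_def asd_wrt_def curvature4_bpst
  unfolding im_prod_expand by (simp add: axis_def)

lemma bpst_not_flat: "\<not> flat4 bpst"
proof
  assume "flat4 bpst"
  then have "curvature4 bpst 0 (axis 1 1) (axis 2 1) = 0" by (simp add: flat4_def)
  then show False unfolding curvature4_bpst im_prod_expand by (simp add: axis_def E_nonzero)
qed

definition quaternionic :: "mat2 \<Rightarrow> bool" where
  "quaternionic M \<longleftrightarrow> M $ 2 $ 2 = cnj (M $ 1 $ 1) \<and> M $ 2 $ 1 = - cnj (M $ 1 $ 2)"

lemma quat_unquat: "quaternionic M \<Longrightarrow> quat (unquat M) = M"
  by (simp add: quaternionic_def mat2_eq quat_nth unquat_def complex_eq_iff)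

lemma quaternionic_mult: "quaternionic M \<Longrightarrow> quaternionic N \<Longrightarrow> quaternionic (M ** N)"
  by (simp add: quaternionic_def mat2_mult_nth algebra_simps)

lemma quaternionic_cadj: "quaternionic M \<Longrightarrow> quaternionic (cadj M)"
  by (simp add: quaternionic_def cadj_nth)

lemma quaternionic_quat: "quaternionic (quat x)"
  by (simp add: quaternionic_def quat_nth complex_eq_iff)

lemma det_mat2: "det (M::mat2) = M$1$1 * M$2$2 - M$1$2 * M$2$1"
  by (rule det_2)

text \<open>For \<open>g\<close> of determinant \<open>1\<close> the adjugate is the inverse, so unitarity identifies it with the adjoint.\<close>
lemma SU2_quaternionic:
  assumes "g \<in> SU2" shows "quaternionic g"
proof -
  let ?a = "g$1$1" and ?b = "g$1$2" and ?c = "g$2$1" and ?d = "g$2$2"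
  have 1: "?a * cnj ?a + ?b * cnj ?b = 1" and 2: "?c * cnj ?a + ?d * cnj ?b = 0"
    and 3: "?a * ?d - ?b * ?c = 1"
    using assms by (auto simp: SU2_def mat2_eq mat2_mult_nth cadj_nth mat_def det_mat2)
  have "?d * (?a * cnj ?a + ?b * cnj ?b) = cnj ?a * (?a * ?d - ?b * ?c) + ?b * (?c * cnj ?a + ?d * cnj ?b)"
    "?c * (?a * cnj ?a + ?b * cnj ?b) = ?a * (?c * cnj ?a + ?d * cnj ?b) - cnj ?b * (?a * ?d - ?b * ?c)"
    by (simp_all add: algebra_simps)
  then have "?d = cnj ?a" "?c = - cnj ?b" unfolding 1 2 3 by simp_all
  then show ?thesis by (simp add: quaternionic_def)
qed

lemma det_quat: "det (quat x) = of_real (x \<bullet> x)"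
  by (simp add: det_mat2 quat_nth inner_4 complex_eq_iff)

lemma cadj_mult: "cadj (A ** B) = cadj B ** cadj A"
  by (simp add: mat2_eq cadj_nth mat2_mult_nth algebra_simps)

lemma cadj_cadj: "cadj (cadj A) = A"
  by (simp add: mat2_eq cadj_nth)

lemma det_cadj: "det (cadj A) = cnj (det A)"
  by (simp add: det_mat2 cadj_nth)

lemma torus_in_SU2: "vector [vector [cis \<theta>, 0], vector [0, cis (- \<theta>)]] \<in> SU2"
  by (simp add: SU2_def mat2_eq mat2_mult_nth cadj_nth mat_def det_mat2 cis_cnj cis_mult)

lemma SU2_left_inverse: "g \<in> SU2 \<Longrightarrow> cadj g ** g = mat 1"
  using matrix_left_right_inverse[of g "cadj g"] by (simp add: SU2_def)

lemma isoK_SU2: "(D, q) \<in> isoK \<Longrightarrow> D \<in> SU2 \<and> q \<in> SU2"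
  using torus_in_SU2 by (auto simp: isoK_def)

text \<open>The action sends \<open>x w\<^sup>*\<close> to \<open>q x D\<^sup>* D w\<^sup>* q\<^sup>* = q (x w\<^sup>*) q\<^sup>*\<close> and preserves \<open>|x|\<^sup>2\<close>, which is
the determinant of the quaternion.\<close>
lemma equivariant4_bpst: "equivariant4 iso_0Id bpst"
  unfolding equivariant4_def
proof (safe)
  fix D q x w assume k: "(D, q) \<in> isoK"
  then have D: "D \<in> SU2" and q: "q \<in> SU2" using isoK_SU2 by auto
  have Q: "quat (act (D, q) y) = q ** quat y ** cadj D" for y
    unfolding act_def prod.case
    by (intro quat_unquat quaternionic_mult quaternionic_cadj SU2_quaternionic D q quaternionic_quat)
  have "complex_of_real (act (D, q) x \<bullet> act (D, q) x) = of_real (x \<bullet> x)"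
    using D q unfolding det_quat[symmetric] Q by (simp add: det_mul det_cadj SU2_def)
  then have n: "act (D, q) x \<bullet> act (D, q) x = x \<bullet> x" by (simp only: of_real_eq_iff)
  have "quat (act (D, q) y) ** cadj (quat (act (D, q) z)) = q ** (quat y ** cadj (quat z)) ** cadj q" for y z
  proof -
    have "quat (act (D, q) y) ** cadj (quat (act (D, q) z)) =
       q ** quat y ** (cadj D ** D) ** cadj (quat z) ** cadj q"
      unfolding Q cadj_mult cadj_cadj by (simp only: matrix_mul_assoc)
    then show ?thesis unfolding SU2_left_inverse[OF D] by (simp add: matrix_mul_assoc)
  qed
  then have "im_prod (act (D, q) x) (act (D, q) w) = q ** im_prod x w ** cadj q"
    by (simp add: im_prod_def mat2_eq mat2_mult_nth algebra_simps)
  then show "bpst (act (D, q) x) (act (D, q) w) = iso_0Id (D, q) ** bpst x w ** cadj (iso_0Id (D, q))"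
    unfolding bpst_def n iso_0Id_def snd_conv
    by (simp only: matrix_scaleR_left matrix_scaleR_right)
qed

text \<open>At the point \<open>x = t\<close> the infinitesimal action of \<open>(a E1, Y)\<close> is \<open>t (Y - a E1)\<close>, so the lift evaluates the
basic instanton on \<open>s + t (Y - a E1)\<close>, where it is \<open>- t\<^sup>2 / (2 + t\<^sup>2) (Y - a E1)\<close>.\<close>
lemma lift_bpst:
  assumes "(s, X, Y) \<in> tangent"
  shows "on_complement (lift4 iso_0Id bpst) t (s, X, Y) =
    conn_form (\<lambda>t. 1 - 4 / (2 + t\<^sup>2)) (\<lambda>t. 2 / (2 + t\<^sup>2)) t (s, X, Y)"
proof -
  define a b c where "a = coE1 Y" and "b = coE2 Y" and "c = coE3 Y"
  have Y: "Y = a *\<^sub>R E1 + b *\<^sub>R E2 + c *\<^sub>R E3"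
    using assms su2_expansion[of Y] by (simp add: tangent_def a_def b_def c_def)
  let ?x = "t *\<^sub>R axis 1 1 :: real^4"
  have xx: "?x \<bullet> ?x = t\<^sup>2" by (simp add: inner_4 axis_def power2_eq_square)
  have ax: "(axis 1 1 :: real^4) $ 1 = 1" "(axis 1 1 :: real^4) $ 2 = 0"
    "(axis 1 1 :: real^4) $ 3 = 0" "(axis 1 1 :: real^4) $ 4 = 0"
    by (simp_all add: axis_def)
  have q: "quat ?x = t *\<^sub>R mat 1" by (simp add: quat_def axis_def)
  have n: "2 + t\<^sup>2 \<noteq> 0" by (smt (verit) zero_le_power2)
  have i: "iact (coE1 X *\<^sub>R E1, Y) ?x $ 1 = 0"
    "iact (coE1 X *\<^sub>R E1, Y) ?x $ 2 = t * (a - coE1 X)"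
    "iact (coE1 X *\<^sub>R E1, Y) ?x $ 3 = t * b" "iact (coE1 X *\<^sub>R E1, Y) ?x $ 4 = t * c"
    unfolding iact_def prod.case q
    by (simp_all add: unquat_def mat2_mult_nth Y E1_def E2_def E3_def mat_def algebra_simps)
  have "on_complement (lift4 iso_0Id bpst) t (s, X, Y) =
     inverse (2 + t\<^sup>2) *\<^sub>R ((- (t\<^sup>2) * (a - coE1 X)) *\<^sub>R E1 + (- (t\<^sup>2) * b) *\<^sub>R E2 + (- (t\<^sup>2) * c) *\<^sub>R E3) + Y"
    unfolding on_complement_def lift4_def prod.case Let_def iso_0Id_def snd_conv bpst_def xx
      im_prod_expand
    by (simp add: i ax power2_eq_square algebra_simps)
  also have "\<dots> = (a - t\<^sup>2 / (2 + t\<^sup>2) * (a - coE1 X)) *\<^sub>R E1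
      + (b - t\<^sup>2 / (2 + t\<^sup>2) * b) *\<^sub>R E2 + (c - t\<^sup>2 / (2 + t\<^sup>2) * c) *\<^sub>R E3"
    unfolding Y by (simp add: algebra_simps divide_inverse)
  also have "\<dots> = conn_form (\<lambda>t. 1 - 4 / (2 + t\<^sup>2)) (\<lambda>t. 2 / (2 + t\<^sup>2)) t (s, X, Y)"
  proof -
    define k where "k = 2 / (2 + t\<^sup>2)"
    have f: "t\<^sup>2 / (2 + t\<^sup>2) = 1 - k" "4 / (2 + t\<^sup>2) = 2 * k"
      using n by (simp_all add: k_def field_simps)
    show ?thesis unfolding conn_form_def f k_def[symmetric]
      by (simp add: a_def[symmetric] b_def[symmetric] c_def[symmetric])
        (simp add: algebra_simps add_divide_distrib diff_divide_distrib flip: scaleR_add_left)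
  qed
  finally show ?thesis .
qed

section \<open>Bubbling and convergence\<close>

lemma uniform_limit_real_bound:
  fixes f :: "real \<Rightarrow> 'a \<Rightarrow> real"
  assumes bound: "\<And>\<epsilon> t. \<epsilon> > 0 \<Longrightarrow> t \<in> S \<Longrightarrow> \<bar>f \<epsilon> t - g t\<bar> \<le> B \<epsilon>" and B: "(B \<longlongrightarrow> 0) at_top"
  shows "uniform_limit S f g at_top"
proof (rule uniform_limitI)
  fix e :: real assume "e > 0"
  then have "eventually (\<lambda>\<epsilon>. B \<epsilon> < e) at_top" using B by (intro order_tendstoD) auto
  then show "eventually (\<lambda>\<epsilon>. \<forall>t\<in>S. dist (f \<epsilon> t) (g t) < e) at_top"
    using eventually_gt_at_top[of 0]
    by eventually_elim (use bound in \<open>force simp: dist_real_def\<close>)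
qed

lemma conn_form_uniform_limit:
  assumes "uniform_limit S a0 b0 at_top" "uniform_limit S a2 b2 at_top"
  shows "uniform_limit S (\<lambda>\<epsilon> t. conn_form (a0 \<epsilon>) (a2 \<epsilon>) t x) (\<lambda>t. conn_form b0 b2 t x) at_top"
proof -
  have "bounded_linear (\<lambda>r. (r * u_minus [x]) *\<^sub>R E1)"
    by (intro bounded_linear_compose[OF bounded_linear_scaleR_left] bounded_linear_mult_left)
  from bounded_linear.uniform_limit[OF this assms(1)]
    bounded_linear.uniform_limit[OF bounded_linear_scaleR_left assms(2)]
  show ?thesis unfolding conn_form_def
    by (intro uniform_limit_add uniform_limit_const)
qed

lemma pullback_scale_conn_form:
  "pullback_scale \<delta> (conn_form a0 a2) t x = conn_form (\<lambda>t. a0 (\<delta> * t)) (\<lambda>t. a2 (\<delta> * t)) t x"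
  by (cases x) (simp add: pullback_scale_def conn_form_def)

lemma frame_tangent: "frame \<subseteq> tangent"
  by (simp add: frame_def tangent_def E_in_su2 zero_su2)

theorem theorem3:
  fixes up lam mu :: "real \<Rightarrow> real" and a0 a2 :: "real \<Rightarrow> real \<Rightarrow> real"
  assumes "candelas_de_la_ossa up lam mu"
    and "\<And>\<epsilon>. \<epsilon> \<ge> 0 \<Longrightarrow> is_R up lam mu \<epsilon> (a0 \<epsilon>) (a2 \<epsilon>)"
  shows "bubbles_asd (\<lambda>\<epsilon>. conn_form (a0 \<epsilon>) (a2 \<epsilon>)) \<and>
    (\<forall>C. compact C \<and> C \<subseteq> {0<..} \<longrightarrow>
       conn_converges_on C (\<lambda>\<epsilon>. conn_form (a0 \<epsilon>) (a2 \<epsilon>)) (R'0 up))"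
proof (intro conjI allI impI)
  let ?s = "\<lambda>t. up t - 1"
  have radial: "radial_instanton ?s lam (\<lambda>t. a0 \<epsilon> t + 1) (a2 \<epsilon>) \<epsilon>" if "\<epsilon> > 0" for \<epsilon>
    using is_R_radial_instanton[OF assms(1) assms(2) that] that by simp
  note s_pos = candelas_gt_1[OF assms(1)]
  \<comment> \<open>The scale on which \<open>\<epsilon> t\<^sup>2\<close>, and with it \<open>z\<close>, is of order one.\<close>
  define \<delta> where "\<delta> \<epsilon> = 1 / sqrt \<epsilon>" for \<epsilon> :: real
  have \<delta>_pos: "\<delta> \<epsilon> > 0" and \<delta>_sq: "\<epsilon> * (\<delta> \<epsilon> * t)\<^sup>2 = t\<^sup>2" if "\<epsilon> > 0" for \<epsilon> t
    using that by (simp_all add: \<delta>_def power_divide)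
  have "conn_converges_on {0<..T} (\<lambda>\<epsilon>. pullback_scale (\<delta> \<epsilon>) (conn_form (a0 \<epsilon>) (a2 \<epsilon>)))
      (on_complement (lift4 iso_0Id bpst))" if T: "T > 0" for T
  proof -
    define \<sigma> where "\<sigma> \<epsilon> = 3/2 * T\<^sup>2 / \<epsilon>" for \<epsilon>
    define B where "B \<epsilon> = T\<^sup>2 / 2 * (exp (\<sigma> \<epsilon> / 6) - 1 + \<sigma> \<epsilon>)" for \<epsilon>
    have \<sigma>_lim: "(\<sigma> \<longlongrightarrow> 0) at_top" unfolding \<sigma>_def
      by (rule tendsto_divide_0[OF tendsto_const filterlim_at_top_imp_at_infinity[OF filterlim_ident]])
    have "(B \<longlongrightarrow> T\<^sup>2 / 2 * (exp (0 / 6) - 1 + 0)) at_top" unfolding B_def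
      by (intro tendsto_intros \<sigma>_lim) simp
    then have B_lim: "(B \<longlongrightarrow> 0) at_top" by simp
    have bounds: "\<bar>a2 \<epsilon> (\<delta> \<epsilon> * t) - 2 / (2 + t\<^sup>2)\<bar> \<le> B \<epsilon> \<and>
        \<bar>a0 \<epsilon> (\<delta> \<epsilon> * t) - (1 - 4 / (2 + t\<^sup>2))\<bar> \<le> 2 * B \<epsilon> + \<sigma> \<epsilon>"
      if eps: "\<epsilon> > 0" and t: "t \<in> {0<..T}" for \<epsilon> t
    proof -
      interpret radial_instanton ?s lam "\<lambda>t. a0 \<epsilon> t + 1" "a2 \<epsilon>" \<epsilon> by (rule radial[OF eps])
      let ?t = "\<delta> \<epsilon> * t"
      have t': "?t > 0" using t \<delta>_pos[OF eps] by simp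
      have s0: "up ?t - 1 > 0" using s_pos[OF t'] by simp
      have exp_ge_one: "1 \<le> exp ((up ?t - 1) / 6)" using s0 by simp
      have tT: "t\<^sup>2 \<le> T\<^sup>2" using t by (intro power_mono) auto
      have "up ?t - 1 \<le> 3/2 * ?t\<^sup>2" by (rule candelas_depth_bounds[OF assms(1) t'])
      also have "?t\<^sup>2 = t\<^sup>2 / \<epsilon>" using \<delta>_sq[OF eps, of t] eps by (simp add: field_simps)
      also have "3/2 * (t\<^sup>2 / \<epsilon>) \<le> \<sigma> \<epsilon>" unfolding \<sigma>_def using tT eps by (simp add: divide_right_mono)
      finally have s\<sigma>: "up ?t - 1 \<le> \<sigma> \<epsilon>" .
      have "\<bar>z ?t - \<epsilon> * ?t\<^sup>2 / 2\<bar> \<le> \<epsilon> * ?t\<^sup>2 / 2 * (exp ((up ?t - 1) / 6) - 1 + (up ?t - 1))"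
        by (rule z_near_quadratic[OF t' candelas_depth_bounds[OF assms(1) t']])
      also have "\<dots> \<le> B \<epsilon>"
        unfolding B_def \<delta>_sq[OF eps]
      proof (intro mult_mono add_mono diff_mono)
        show "0 \<le> exp ((up ?t - 1) / 6) - 1 + (up ?t - 1)" using exp_ge_one s0 by linarith
      qed (use s\<sigma> tT in auto)
      finally have "\<bar>z ?t - \<epsilon> * ?t\<^sup>2 / 2\<bar> \<le> B \<epsilon>" .
      from near_bpst[OF t' this, unfolded \<delta>_sq[OF eps]] s\<sigma> show ?thesis by linarith
    qed
    have "uniform_limit {0<..T} (\<lambda>\<epsilon> t. a2 \<epsilon> (\<delta> \<epsilon> * t)) (\<lambda>t. 2 / (2 + t\<^sup>2)) at_top"
      by (rule uniform_limit_real_bound[OF _ B_lim]) (use bounds in blast)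
    moreover have "uniform_limit {0<..T} (\<lambda>\<epsilon> t. a0 \<epsilon> (\<delta> \<epsilon> * t)) (\<lambda>t. 1 - 4 / (2 + t\<^sup>2)) at_top"
    proof (rule uniform_limit_real_bound)
      have "((\<lambda>\<epsilon>. 2 * B \<epsilon> + \<sigma> \<epsilon>) \<longlongrightarrow> 2 * 0 + 0) at_top" by (intro tendsto_intros B_lim \<sigma>_lim)
      then show "((\<lambda>\<epsilon>. 2 * B \<epsilon> + \<sigma> \<epsilon>) \<longlongrightarrow> 0) at_top" by simp
    qed (use bounds in blast)
    ultimately have lim: "uniform_limit {0<..T}
        (\<lambda>\<epsilon> t. conn_form (\<lambda>t. a0 \<epsilon> (\<delta> \<epsilon> * t)) (\<lambda>t. a2 \<epsilon> (\<delta> \<epsilon> * t)) t x)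
        (\<lambda>t. conn_form (\<lambda>t. 1 - 4 / (2 + t\<^sup>2)) (\<lambda>t. 2 / (2 + t\<^sup>2)) t x) at_top" for x
      by (intro conn_form_uniform_limit)
    show ?thesis unfolding conn_converges_on_def
    proof
      fix x assume "x \<in> frame"
      then have "x \<in> tangent" using frame_tangent by blast
      then have "on_complement (lift4 iso_0Id bpst) t x =
          conn_form (\<lambda>t. 1 - 4 / (2 + t\<^sup>2)) (\<lambda>t. 2 / (2 + t\<^sup>2)) t x" for t
        using lift_bpst by (cases x) blast
      then show "uniform_limit {0<..T} (\<lambda>\<epsilon> t. pullback_scale (\<delta> \<epsilon>) (conn_form (a0 \<epsilon>) (a2 \<epsilon>)) t x)
          (\<lambda>t. on_complement (lift4 iso_0Id bpst) t x) at_top"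
        using lim by (simp add: pullback_scale_conn_form)
    qed
  qed
  moreover have "(\<delta> \<longlongrightarrow> 0) at_top" unfolding \<delta>_def
    by (rule tendsto_divide_0[OF tendsto_const filterlim_at_top_imp_at_infinity[OF sqrt_at_top]])
  ultimately show "bubbles_asd (\<lambda>\<epsilon>. conn_form (a0 \<epsilon>) (a2 \<epsilon>))"
    unfolding bubbles_asd_def
    using \<delta>_pos su2_conn4_bpst equivariant4_bpst asd4_bpst bpst_not_flat by blast

  fix C :: "real set" assume C: "compact C \<and> C \<subseteq> {0<..}"
  have "continuous_on C (\<lambda>t. exp (?s t / 2) / ?s t)"
  proof (intro continuous_at_imp_continuous_on ballI)
    fix t assume "t \<in> C"
    then have t: "t > 0" using C by auto
    have "isCont up t" using assms(1) t by (auto simp: candelas_de_la_ossa_def intro: DERIV_isCont)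
    then show "isCont (\<lambda>t. exp (?s t / 2) / ?s t) t"
      using s_pos[OF t] by (intro continuous_intros) auto
  qed
  then have "bounded ((\<lambda>t. exp (?s t / 2) / ?s t) ` C)"
    using C by (intro compact_imp_bounded compact_continuous_image) auto
  then obtain M where norm_le: "\<And>y. y \<in> (\<lambda>t. exp (?s t / 2) / ?s t) ` C \<Longrightarrow> norm y \<le> M"
    unfolding bounded_iff by blast
  then have M: "exp (?s t / 2) / ?s t \<le> M" if "t \<in> C" for t
  proof -
    have "norm (exp (?s t / 2) / ?s t) \<le> M" using norm_le that by blast
    then show ?thesis unfolding real_norm_def by (rule abs_le_D1)
  qed
  have bounds: "\<bar>a2 \<epsilon> t - 0\<bar> \<le> 6 * M / \<epsilon> \<and> \<bar>a0 \<epsilon> t - 2 / (up t + 1)\<bar> \<le> 6 * M / \<epsilon>"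
    if eps: "\<epsilon> > 0" and tC: "t \<in> C" for \<epsilon> t
  proof -
    interpret radial_instanton ?s lam "\<lambda>t. a0 \<epsilon> t + 1" "a2 \<epsilon>" \<epsilon> by (rule radial[OF eps])
    have t: "t > 0" using C tC by auto
    have e: "k * exp (?s t / 2) / (\<epsilon> * ?s t) = k / \<epsilon> * (exp (?s t / 2) / ?s t)" for k by simp
    have le: "k * exp (?s t / 2) / (\<epsilon> * ?s t) \<le> 6 / \<epsilon> * M" if "0 < k" "k \<le> 6" for k
      unfolding e using that eps M[OF tC] s_pos[OF t]
      by (intro mult_mono divide_right_mono) (auto intro: order_trans[OF _ M[OF tC]])
    have "\<bar>a2 \<epsilon> t\<bar> \<le> 6 / \<epsilon> * M" using c_le[OF t] c_pos[OF t] le[of 3] by linarith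
    moreover have "a0 \<epsilon> t + 1 - (?s t + 4) / (?s t + 2) = a0 \<epsilon> t - 2 / (up t + 1)"
      using s_pos[OF t] by (simp add: divide_simps) (simp add: algebra_simps)
    then have "\<bar>a0 \<epsilon> t - 2 / (up t + 1)\<bar> \<le> 6 / \<epsilon> * M"
      using p_near_abelian[OF t] le[of 6] by linarith
    ultimately show ?thesis by simp
  qed
  have lim: "((\<lambda>\<epsilon>. 6 * M / \<epsilon>) \<longlongrightarrow> 0) at_top"
    by (rule tendsto_divide_0[OF tendsto_const filterlim_at_top_imp_at_infinity[OF filterlim_ident]])
  have "uniform_limit C a2 (\<lambda>t. 0) at_top" "uniform_limit C a0 (\<lambda>t. 2 / (up t + 1)) at_top"
    by (rule uniform_limit_real_bound[OF _ lim]; use bounds in blast)+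
  then show "conn_converges_on C (\<lambda>\<epsilon>. conn_form (a0 \<epsilon>) (a2 \<epsilon>)) (R'0 up)"
    unfolding conn_converges_on_def R'0_def by (auto intro: conn_form_uniform_limit)
qed

end
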